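(* There exists a compact connected Abelian topological group $G$ of weight $\omega_1$ whose underlying topological space is not in the class $\mathcal{R}$, and hence is not Valdivia compact.
   Context: All compact spaces (in particular compact groups) are Hausdorff, and "map" means continuous map. The weight of a space is the least cardinality of a base of its topology. Valdivia compact: Let $I=[0,1]$ and let $A$ be a set. The sigma-product $\Sigma\subset I^A$ (with zero base point) is the set of all points $\{x_\alpha\}_{\alpha\in A}\in I^A$ such that $\{\alpha\in A: x_\alpha\neq 0\}$ is countable. A compact space $K$ is Valdivia compact if, for some set $A$, it can be embedded in the Tikhonov cube $I^A$ in such a way that $K\cap\Sigma$ is dense in $K$. The class $\mathcal{R}$: A map $f:X\to Y$ is right-invertible if there exists a map $g:Y\to X$ such that $fg:Y\to Y$ is the identity. A transfinite inverse sequence $\{X_\alpha;p_\alpha^\beta:\alpha<\beta<\kappa\}$ (indexed by ordinals less than an ordinal $\kappa$, with bonding maps $p_\alpha^\beta:X_\beta\to X_\alpha$) is continuous if for every limit ordinal $\delta<\kappa$ the space $X_\delta$ is naturally homeomorphic to $\varprojlim\{X_\alpha;p_\alpha^\beta:\alpha<\beta<\delta\}$. The class $\mathcal{R}$ is the smallest class of spaces containing all compact metric spaces which is closed under inverse limits of continuous transfinite inverse sequences whose bonding maps are right-invertible. (Classes of spaces are considered up to homeomorphism.) Every Valdivia compact space belongs to $\mathcal{R}$. *)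

theory Defs
  imports "HOL-Analysis.Analysis" "HOL-Algebra.Group"
begin

unbundle cardinal_syntax

section \<open>Topological groups and weight\<close>

definition topological_group :: "('a, 'm) monoid_scheme \<Rightarrow> 'a topology \<Rightarrow> bool" where
  "topological_group G T \<longleftrightarrow>
     group G \<and> topspace T = carrier G \<and>
     continuous_map (prod_topology T T) T (\<lambda>(x, y). x \<otimes>\<^bsub>G\<^esub> y) \<and>
     continuous_map T T (\<lambda>x. inv\<^bsub>G\<^esub> x)"

definition base_of :: "'a topology \<Rightarrow> 'a set set \<Rightarrow> bool" where
  "base_of X \<B> \<longleftrightarrow> openin X = arbitrary union_of (\<lambda>U. U \<in> \<B>)"

definition has_weight :: "'a topology \<Rightarrow> 'c rel \<Rightarrow> bool" where
  "has_weight X \<kappa> \<longleftrightarrow>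
     (\<exists>\<B>. base_of X \<B> \<and> |\<B>| =o \<kappa>) \<and> (\<forall>\<B>. base_of X \<B> \<longrightarrow> \<kappa> \<le>o |\<B>| )"

abbreviation omega1 :: "nat set rel" where
  "omega1 \<equiv> cardSuc natLeq"


section \<open>Valdivia compacta\<close>

abbreviation unit_cube :: "'k set \<Rightarrow> ('k \<Rightarrow> real) topology" where
  "unit_cube A \<equiv> product_topology (\<lambda>_. top_of_set {0..1}) A"

definition sigma_product :: "'k set \<Rightarrow> ('k \<Rightarrow> real) set" where
  "sigma_product A = {x \<in> topspace (unit_cube A). countable {\<alpha> \<in> A. x \<alpha> \<noteq> 0}}"

definition valdivia_embedding :: "'a topology \<Rightarrow> 'k set \<Rightarrow> ('a \<Rightarrow> 'k \<Rightarrow> real) \<Rightarrow> bool" where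
  "valdivia_embedding K A f \<longleftrightarrow>
     embedding_map K (unit_cube A) f \<and>
     subtopology (unit_cube A) (f ` topspace K)
       closure_of (f ` topspace K \<inter> sigma_product A) = f ` topspace K"

text \<open>The index set may be taken among sets of real functions on \<open>K\<close>
  (identify equal coordinate functions); lemma \<open>valdivia_compactI\<close> below shows
  that index sets of any other type give the same notion.\<close>

definition valdivia_compact :: "'a topology \<Rightarrow> bool" where
  "valdivia_compact K \<longleftrightarrow>
     compact_space K \<and> Hausdorff_space K \<and>
     (\<exists>(A :: ('a \<Rightarrow> real) set) f. valdivia_embedding K A f)"


section \<open>Transfinite inverse sequences and the class R\<close>

text \<open>An ordinal \<open>\<kappa>\<close> is represented by a well-order \<open>r\<close>, the ordinals below \<open>\<kappa>\<close> by the
  elements of \<open>Field r\<close>.  The map \<open>p \<alpha> \<beta>\<close> goes from \<open>X \<beta>\<close> to \<open>X \<alpha>\<close>; for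
  convenience \<open>p \<alpha> \<alpha>\<close> is included and is the identity.\<close>

definition inverse_sequence ::
    "'i rel \<Rightarrow> ('i \<Rightarrow> 'a topology) \<Rightarrow> ('i \<Rightarrow> 'i \<Rightarrow> 'a \<Rightarrow> 'a) \<Rightarrow> bool" where
  "inverse_sequence r X p \<longleftrightarrow>
     Well_order r \<and>
     (\<forall>(\<alpha>, \<beta>) \<in> r. continuous_map (X \<beta>) (X \<alpha>) (p \<alpha> \<beta>)) \<and>
     (\<forall>\<alpha> \<in> Field r. \<forall>x \<in> topspace (X \<alpha>). p \<alpha> \<alpha> x = x) \<and>
     (\<forall>\<alpha> \<beta> \<gamma>. (\<alpha>, \<beta>) \<in> r \<longrightarrow> (\<beta>, \<gamma>) \<in> r \<longrightarrow>
        (\<forall>x \<in> topspace (X \<gamma>). p \<alpha> \<beta> (p \<beta> \<gamma> x) = p \<alpha> \<gamma> x))"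

definition inverse_limit ::
    "'i rel \<Rightarrow> 'i set \<Rightarrow> ('i \<Rightarrow> 'a topology) \<Rightarrow> ('i \<Rightarrow> 'i \<Rightarrow> 'a \<Rightarrow> 'a) \<Rightarrow> ('i \<Rightarrow> 'a) topology" where
  "inverse_limit r D X p =
     subtopology (product_topology X D)
       {x. \<forall>\<alpha> \<in> D. \<forall>\<beta> \<in> D. (\<alpha>, \<beta>) \<in> r \<longrightarrow> p \<alpha> \<beta> (x \<beta>) = x \<alpha>}"

text \<open>Limit ordinals are nonzero; \<open>underS r \<delta>\<close> is the set of strict predecessors of \<open>\<delta>\<close>.\<close>

definition limit_index :: "'i rel \<Rightarrow> 'i \<Rightarrow> bool" where
  "limit_index r \<delta> \<longleftrightarrow>
     \<delta> \<in> Field r \<and> underS r \<delta> \<noteq> {} \<and>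
     (\<forall>\<alpha> \<in> underS r \<delta>. \<exists>\<beta> \<in> underS r \<delta>. (\<alpha>, \<beta>) \<in> r \<and> \<alpha> \<noteq> \<beta>)"

definition continuous_inverse_sequence ::
    "'i rel \<Rightarrow> ('i \<Rightarrow> 'a topology) \<Rightarrow> ('i \<Rightarrow> 'i \<Rightarrow> 'a \<Rightarrow> 'a) \<Rightarrow> bool" where
  "continuous_inverse_sequence r X p \<longleftrightarrow>
     inverse_sequence r X p \<and>
     (\<forall>\<delta>. limit_index r \<delta> \<longrightarrow>
        homeomorphic_map (X \<delta>) (inverse_limit r (underS r \<delta>) X p)
          (\<lambda>x. \<lambda>\<alpha> \<in> underS r \<delta>. p \<alpha> \<delta> x))"

definition right_invertible_bonding ::
    "'i rel \<Rightarrow> ('i \<Rightarrow> 'a topology) \<Rightarrow> ('i \<Rightarrow> 'i \<Rightarrow> 'a \<Rightarrow> 'a) \<Rightarrow> bool" where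
  "right_invertible_bonding r X p \<longleftrightarrow>
     (\<forall>(\<alpha>, \<beta>) \<in> r. \<alpha> \<noteq> \<beta> \<longrightarrow> retraction_map (X \<beta>) (X \<alpha>) (p \<alpha> \<beta>))"

text \<open>The least class in each type \<open>'a\<close>; the spaces of an inverse sequence live in \<open>'a\<close>
  and its indices in the type \<open>('a \<times> 'a) set\<close>.  These bounds on the types are harmless:
  by \<open>class_R_homeomorphic\<close> and \<open>class_R_inverse_limit\<close> below, the class is invariant under
  homeomorphisms between spaces of different types, and closed under limits of
  sequences whose spaces and indices have arbitrary types.\<close>

inductive class_R :: "'a topology \<Rightarrow> bool" where
  compact_metrizable: "compact_space X \<Longrightarrow> metrizable_space X \<Longrightarrow> class_R X"
| limit_of_sequence:
    "continuous_inverse_sequence (r :: ('a \<times> 'a) set rel) Y p \<Longrightarrow>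
     right_invertible_bonding r Y p \<Longrightarrow>
     \<forall>\<alpha> \<in> Field r. class_R (Y \<alpha>) \<Longrightarrow>
     X homeomorphic_space inverse_limit r (Field r) Y p \<Longrightarrow> class_R X"

section \<open>Independence of the types\<close>

lemma valdivia_compactI:
  fixes K :: "'a topology" and A :: "'k set"
  assumes "compact_space K" "Hausdorff_space K" and f: "valdivia_embedding K A f"
  shows "valdivia_compact K"
proof -
  define c where "c \<alpha> = (\<lambda>x. f x \<alpha>)" for \<alpha>
  define B where "B = c ` A"
  define a where "a = inv_into A c"
  have a: "a b \<in> A" "c (a b) = b" if "b \<in> B" for b
    using that unfolding a_def B_def by (auto simp: inv_into_into f_inv_into_f)
  have injA: "inj_on a B" by (metis a(2) inj_onI)
  define \<pi> where "\<pi> = (\<lambda>z::'k\<Rightarrow>real. \<lambda>b\<in>B. z (a b))"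
  define \<sigma> where "\<sigma> = (\<lambda>w::('a\<Rightarrow>real)\<Rightarrow>real. \<lambda>\<alpha>\<in>A. w (c \<alpha>))"
  define g where "g = \<pi> \<circ> f"
  have cf: "continuous_map K (unit_cube A) f"
    using f unfolding valdivia_embedding_def embedding_map_def
    by (meson continuous_map_in_subtopology homeomorphic_imp_continuous_map)
  have c\<pi>: "continuous_map (unit_cube A) (unit_cube B) \<pi>"
    unfolding continuous_map_componentwise \<pi>_def
    by (auto intro!: continuous_map_product_projection a)
  have c\<sigma>: "continuous_map (unit_cube B) (unit_cube A) \<sigma>"
    unfolding continuous_map_componentwise \<sigma>_def
    by (auto intro!: continuous_map_product_projection simp: B_def)
  have \<sigma>g: "\<sigma> (g x) = f x" if "x \<in> topspace K" for x
  proof -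
    have "f x \<in> extensional A"
      using cf that by (force simp: continuous_map_def PiE_def)
    moreover have "\<pi> (f x) (c \<alpha>) = f x \<alpha>" if "\<alpha> \<in> A" for \<alpha>
    proof -
      have "c \<alpha> \<in> B" using that by (simp add: B_def)
      then have "c (a (c \<alpha>)) x = c \<alpha> x" using a by simp
      then show ?thesis using \<open>c \<alpha> \<in> B\<close> by (simp add: \<pi>_def c_def)
    qed
    ultimately show ?thesis
      unfolding \<sigma>_def g_def by (auto simp: fun_eq_iff extensional_def)
  qed
  obtain k where k: "homeomorphic_maps K (subtopology (unit_cube A) (f ` topspace K)) f k"
    using f unfolding valdivia_embedding_def embedding_map_def homeomorphic_map_maps by blast
  have cg: "continuous_map K (unit_cube B) g"
    unfolding g_def using cf c\<pi> continuous_map_compose by blast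
  have "homeomorphic_maps K (subtopology (unit_cube B) (g ` topspace K)) g (k \<circ> \<sigma>)"
    unfolding homeomorphic_maps_def
  proof (intro conjI)
    show "continuous_map K (subtopology (unit_cube B) (g ` topspace K)) g"
      using cg by (simp add: continuous_map_in_subtopology)
    show "continuous_map (subtopology (unit_cube B) (g ` topspace K)) K (k \<circ> \<sigma>)"
    proof (rule continuous_map_compose)
      show "continuous_map (subtopology (unit_cube B) (g ` topspace K))
              (subtopology (unit_cube A) (f ` topspace K)) \<sigma>"
        using c\<sigma> \<sigma>g
        by (auto simp: continuous_map_in_subtopology intro!: continuous_map_from_subtopology)
      show "continuous_map (subtopology (unit_cube A) (f ` topspace K)) K k"
        using k by (simp add: homeomorphic_maps_def)
    qed
    show "\<forall>x\<in>topspace K. (k \<circ> \<sigma>) (g x) = x"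
      using k \<sigma>g by (simp add: homeomorphic_maps_def)
    then show "\<forall>y\<in>topspace (subtopology (unit_cube B) (g ` topspace K)). g ((k \<circ> \<sigma>) y) = y"
      by auto
  qed
  then have emb: "embedding_map K (unit_cube B) g"
    unfolding embedding_map_def homeomorphic_map_maps by blast
  let ?XA = "subtopology (unit_cube A) (f ` topspace K)"
  let ?XB = "subtopology (unit_cube B) (g ` topspace K)"
  have ci: "continuous_map ?XA ?XB \<pi>"
    using c\<pi> by (auto simp: continuous_map_in_subtopology g_def intro!: continuous_map_from_subtopology)
  have sub: "\<pi> ` (f ` topspace K \<inter> sigma_product A) \<subseteq> g ` topspace K \<inter> sigma_product B"
  proof
    fix y assume "y \<in> \<pi> ` (f ` topspace K \<inter> sigma_product A)"
    then obtain x where x: "x \<in> topspace K" "f x \<in> sigma_product A" and y: "y = \<pi> (f x)"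
      by blast
    have "a ` {b \<in> B. \<pi> (f x) b \<noteq> 0} \<subseteq> {\<alpha> \<in> A. f x \<alpha> \<noteq> 0}"
      using a by (auto simp: \<pi>_def)
    moreover have "countable {\<alpha> \<in> A. f x \<alpha> \<noteq> 0}"
      using x by (simp add: sigma_product_def)
    ultimately have "countable (a ` {b \<in> B. \<pi> (f x) b \<noteq> 0})"
      by (rule countable_subset)
    then have "countable {b \<in> B. \<pi> (f x) b \<noteq> 0}"
      by (rule countable_image_inj_on) (auto intro: inj_on_subset[OF injA])
    moreover have "\<pi> (f x) \<in> topspace (unit_cube B)"
      using continuous_map_image_subset_topspace[OF cg] x(1) unfolding g_def by (metis comp_apply image_subset_iff)
    ultimately show "y \<in> g ` topspace K \<inter> sigma_product B"
      unfolding y sigma_product_def g_def using x(1) by simp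
  qed
  have "g ` topspace K = \<pi> ` (?XA closure_of (f ` topspace K \<inter> sigma_product A))"
    using f by (simp add: valdivia_embedding_def g_def image_comp)
  also have "\<dots> \<subseteq> ?XB closure_of (\<pi> ` (f ` topspace K \<inter> sigma_product A))"
    using ci by (rule continuous_map_image_closure_subset)
  also have "\<dots> \<subseteq> ?XB closure_of (g ` topspace K \<inter> sigma_product B)"
    using sub by (rule closure_of_mono)
  finally have "g ` topspace K \<subseteq> ?XB closure_of (g ` topspace K \<inter> sigma_product B)" .
  moreover have "?XB closure_of (g ` topspace K \<inter> sigma_product B) \<subseteq> g ` topspace K"
    using closure_of_subset_topspace[of ?XB] by auto
  ultimately show ?thesis
    using assms emb unfolding valdivia_compact_def valdivia_embedding_def by blast
qed

lemma topspace_inverse_limit: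
  "x \<in> topspace (inverse_limit r D X p) \<longleftrightarrow>
     x \<in> extensional D \<and> (\<forall>\<alpha>\<in>D. x \<alpha> \<in> topspace (X \<alpha>)) \<and>
     (\<forall>\<alpha>\<in>D. \<forall>\<beta>\<in>D. (\<alpha>, \<beta>) \<in> r \<longrightarrow> p \<alpha> \<beta> (x \<beta>) = x \<alpha>)"
  by (auto simp: inverse_limit_def PiE_iff)

lemma continuous_map_into_inverse_limit:
  assumes "\<And>\<alpha>. \<alpha> \<in> D \<Longrightarrow> continuous_map Z (X \<alpha>) (\<lambda>z. f z \<alpha>)"
    and "\<And>z. z \<in> topspace Z \<Longrightarrow> f z \<in> extensional D"
    and "\<And>z \<alpha> \<beta>. \<lbrakk>z \<in> topspace Z; \<alpha> \<in> D; \<beta> \<in> D; (\<alpha>, \<beta>) \<in> r\<rbrakk> \<Longrightarrow> p \<alpha> \<beta> (f z \<beta>) = f z \<alpha>"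
  shows "continuous_map Z (inverse_limit r D X p) f"
  unfolding inverse_limit_def continuous_map_in_subtopology
  using assms by (auto simp: continuous_map_componentwise)

lemma continuous_map_inverse_limit_projection:
  assumes "\<alpha> \<in> D"
  shows "continuous_map (inverse_limit r D X p) (X \<alpha>) (\<lambda>x. x \<alpha>)"
  unfolding inverse_limit_def using assms
  by (intro continuous_map_from_subtopology continuous_map_product_projection)

lemma inverse_sequence_sections:
  fixes r :: "'i rel" and Y :: "'i \<Rightarrow> 'b topology"
  assumes cont: "continuous_inverse_sequence r Y p" and ri: "right_invertible_bonding r Y p"
    and \<alpha>: "\<alpha> \<in> Field r"
  obtains t where
    "\<And>\<beta>. \<beta> \<in> Field r \<Longrightarrow> continuous_map (Y \<alpha>) (Y \<beta>) (t \<beta>)"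
    "\<And>\<beta> \<gamma> y. \<lbrakk>(\<beta>, \<gamma>) \<in> r; y \<in> topspace (Y \<alpha>)\<rbrakk> \<Longrightarrow> p \<beta> \<gamma> (t \<gamma> y) = t \<beta> y"
    "\<And>y. y \<in> topspace (Y \<alpha>) \<Longrightarrow> t \<alpha> y = y"
proof -
  have iseq: "inverse_sequence r Y p" using cont by (simp add: continuous_inverse_sequence_def)
  have W: "Well_order r" using iseq by (simp add: inverse_sequence_def)
  have wo: "wo_rel r" using W by (simp add: wo_rel_def)
  note TOTALS = wo_rel.TOTALS[OF wo] and TRANS = wo_rel.TRANS[OF wo]
    and REFL = wo_rel.REFL[OF wo] and ANTISYM = wo_rel.ANTISYM[OF wo]
  have pc: "continuous_map (Y \<beta>) (Y \<gamma>) (p \<gamma> \<beta>)" if "(\<gamma>, \<beta>) \<in> r" for \<beta> \<gamma>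
    using iseq that by (auto simp: inverse_sequence_def)
  have pid: "p \<beta> \<beta> x = x" if "\<beta> \<in> Field r" "x \<in> topspace (Y \<beta>)" for \<beta> x
    using iseq that by (auto simp: inverse_sequence_def)
  have pp: "p \<beta> \<gamma> (p \<gamma> \<delta> x) = p \<beta> \<delta> x"
    if "(\<beta>, \<gamma>) \<in> r" "(\<gamma>, \<delta>) \<in> r" "x \<in> topspace (Y \<delta>)" for \<beta> \<gamma> \<delta> x
    using iseq that unfolding inverse_sequence_def by blast
  define P where "P f \<gamma> u \<longleftrightarrow> (\<gamma> \<in> Field r \<longrightarrow> continuous_map (Y \<alpha>) (Y \<gamma>) u \<and>
      (\<forall>\<beta>\<in>underS r \<gamma>. \<forall>y\<in>topspace (Y \<alpha>). p \<beta> \<gamma> (u y) = f \<beta> y) \<and>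
      ((\<gamma>, \<alpha>) \<in> r \<longrightarrow> (\<forall>y\<in>topspace (Y \<alpha>). u y = p \<gamma> \<alpha> y)))" for f \<gamma> u
  have "\<exists>t. \<forall>\<gamma>. P t \<gamma> (t \<gamma>)"
  proof (rule dependent_wf_choice[where R = "r - Id" and P = P])
    show "wf (r - Id)" using W by (simp add: well_order_on_def)
    show "P f \<gamma> u = P g \<gamma> u" if "\<And>z. (z, \<gamma>) \<in> r - Id \<Longrightarrow> f z = g z" for f g \<gamma> u
      using that unfolding P_def underS_def by auto
    fix \<gamma> f assume H: "\<And>\<beta>. (\<beta>, \<gamma>) \<in> r - Id \<Longrightarrow> P f \<beta> (f \<beta>)"
    have below: "(\<beta>, \<gamma>) \<in> r - Id" "\<beta> \<in> Field r" if "\<beta> \<in> underS r \<gamma>" for \<beta>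
      using that by (auto simp: underS_def Field_def)
    have fc: "continuous_map (Y \<alpha>) (Y \<beta>) (f \<beta>)" if "\<beta> \<in> underS r \<gamma>" for \<beta>
      using H[OF below(1)[OF that]] below(2)[OF that] by (simp add: P_def)
    have fp: "p \<beta> \<delta> (f \<delta> y) = f \<beta> y"
      if "\<beta> \<in> underS r \<gamma>" "\<delta> \<in> underS r \<gamma>" "(\<beta>, \<delta>) \<in> r" "y \<in> topspace (Y \<alpha>)" for \<beta> \<delta> y
    proof (cases "\<beta> = \<delta>")
      case True
      have "f \<beta> y \<in> topspace (Y \<beta>)" using fc[OF that(1)] that(4) by (auto simp: continuous_map_def)
      then show ?thesis using True pid below(2)[OF that(1)] by simp
    next
      case False
      then have "\<beta> \<in> underS r \<delta>" using that by (simp add: underS_def)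
      then show ?thesis using H[OF below(1)[OF that(2)]] below(2)[OF that(2)] that by (simp add: P_def)
    qed
    have fid: "f \<beta> y = p \<beta> \<alpha> y"
      if "\<beta> \<in> underS r \<gamma>" "(\<beta>, \<alpha>) \<in> r" "y \<in> topspace (Y \<alpha>)" for \<beta> y
      using H[OF below(1)[OF that(1)]] below(2)[OF that(1)] that by (simp add: P_def)
    show "\<exists>u. P f \<gamma> u"
    proof (cases "\<gamma> \<in> Field r")
      case False then show ?thesis by (simp add: P_def)
    next
      case True
      consider (le) "(\<gamma>, \<alpha>) \<in> r"
        | (lim) "(\<gamma>, \<alpha>) \<notin> r" "limit_index r \<gamma>"
        | (succ) \<delta> where "(\<gamma>, \<alpha>) \<notin> r" "\<delta> \<in> underS r \<gamma>"
            "\<forall>\<beta>\<in>underS r \<gamma>. \<not> ((\<delta>, \<beta>) \<in> r \<and> \<delta> \<noteq> \<beta>)"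
      proof -
        have ne: "underS r \<gamma> \<noteq> {}" if "(\<gamma>, \<alpha>) \<notin> r"
        proof -
          have "(\<alpha>, \<gamma>) \<in> r" "\<alpha> \<noteq> \<gamma>" using that TOTALS[rule_format, OF True \<alpha>] wo_rel.REFL[OF wo] True by (auto simp: refl_on_def)
          then show ?thesis by (auto simp: underS_def)
        qed
        have "limit_index r \<gamma>" if "(\<gamma>, \<alpha>) \<notin> r"
          "\<not> (\<exists>\<delta>\<in>underS r \<gamma>. \<forall>\<beta>\<in>underS r \<gamma>. \<not> ((\<delta>, \<beta>) \<in> r \<and> \<delta> \<noteq> \<beta>))"
          unfolding limit_index_def using ne[OF that(1)] that(2) True by simp
        then show thesis using that by metis
      qed
      then show ?thesis
      proof cases
        case le
        have "P f \<gamma> (p \<gamma> \<alpha>)"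
          unfolding P_def
        proof (intro impI conjI ballI)
          fix \<beta> y assume b: "\<beta> \<in> underS r \<gamma>" "y \<in> topspace (Y \<alpha>)"
          then have "(\<beta>, \<gamma>) \<in> r" by (simp add: underS_def)
          moreover from this le have "(\<beta>, \<alpha>) \<in> r" using TRANS by (meson transD)
          ultimately show "p \<beta> \<gamma> (p \<gamma> \<alpha> y) = f \<beta> y" using b fid pp le by simp
        qed (use pc le in auto)
        then show ?thesis by blast
      next
        case lim
        obtain k where k: "homeomorphic_maps (Y \<gamma>) (inverse_limit r (underS r \<gamma>) Y p)
            (\<lambda>x. \<lambda>\<beta>\<in>underS r \<gamma>. p \<beta> \<gamma> x) k"
          using cont lim(2) unfolding continuous_inverse_sequence_def homeomorphic_map_maps by blast
        define v where "v = (\<lambda>y. \<lambda>\<beta>\<in>underS r \<gamma>. f \<beta> y)"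
        have v: "continuous_map (Y \<alpha>) (inverse_limit r (underS r \<gamma>) Y p) v"
          by (rule continuous_map_into_inverse_limit) (use fc fp in \<open>auto simp: v_def\<close>)
        have "P f \<gamma> (k \<circ> v)"
          unfolding P_def
        proof (intro impI conjI ballI)
          show "continuous_map (Y \<alpha>) (Y \<gamma>) (k \<circ> v)"
            using v k by (auto simp: homeomorphic_maps_def intro: continuous_map_compose)
          fix \<beta> y assume b: "\<beta> \<in> underS r \<gamma>" "y \<in> topspace (Y \<alpha>)"
          have "v y \<in> topspace (inverse_limit r (underS r \<gamma>) Y p)"
            using v b by (auto simp: continuous_map_def)
          then have "(\<lambda>\<beta>\<in>underS r \<gamma>. p \<beta> \<gamma> (k (v y))) = v y"
            using k by (simp add: homeomorphic_maps_def)
          from fun_cong[OF this, of \<beta>] show "p \<beta> \<gamma> ((k \<circ> v) y) = f \<beta> y"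
            using b by (simp add: v_def)
        qed (use lim in auto)
        then show ?thesis by blast
      next
        case succ
        have dr: "(\<delta>, \<gamma>) \<in> r" "\<delta> \<noteq> \<gamma>" using succ by (auto simp: underS_def)
        then have "retraction_map (Y \<gamma>) (Y \<delta>) (p \<delta> \<gamma>)"
          using ri by (auto simp: right_invertible_bonding_def)
        then obtain g where g: "retraction_maps (Y \<gamma>) (Y \<delta>) (p \<delta> \<gamma>) g"
          unfolding retraction_map_def by blast
        have "P f \<gamma> (g \<circ> f \<delta>)"
          unfolding P_def
        proof (intro impI conjI ballI)
          show "continuous_map (Y \<alpha>) (Y \<gamma>) (g \<circ> f \<delta>)"
            using g fc[OF succ(2)] by (auto simp: retraction_maps_def intro: continuous_map_compose)
          fix \<beta> y assume b: "\<beta> \<in> underS r \<gamma>" "y \<in> topspace (Y \<alpha>)"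
          have bd: "(\<beta>, \<delta>) \<in> r"
          proof (cases "\<beta> = \<delta>")
            case True
            then show ?thesis using wo_rel.REFL[OF wo] below(2)[OF b(1)] by (simp add: refl_on_def)
          next
            case False
            then have "(\<delta>, \<beta>) \<notin> r" using succ(3) b(1) by blast
            then show ?thesis using TOTALS below(2)[OF b(1)] below(2)[OF succ(2)] by blast
          qed
          have fy: "f \<delta> y \<in> topspace (Y \<delta>)"
            using fc[OF succ(2)] b by (auto simp: continuous_map_def)
          have gy: "g (f \<delta> y) \<in> topspace (Y \<gamma>)"
            using g fy by (auto simp: retraction_maps_def continuous_map_def)
          have "p \<beta> \<gamma> (g (f \<delta> y)) = p \<beta> \<delta> (p \<delta> \<gamma> (g (f \<delta> y)))"
            using pp[OF bd dr(1) gy] by simp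
          also have "\<dots> = p \<beta> \<delta> (f \<delta> y)" using g fy by (simp add: retraction_maps_def)
          also have "\<dots> = f \<beta> y" using fp b succ bd by blast
          finally show "p \<beta> \<gamma> ((g \<circ> f \<delta>) y) = f \<beta> y" by simp
        qed (use succ in auto)
        then show ?thesis by blast
      qed
    qed
  qed
  then obtain t where t: "\<And>\<gamma>. P t \<gamma> (t \<gamma>)" by blast
  show thesis
  proof
    show "continuous_map (Y \<alpha>) (Y \<beta>) (t \<beta>)" if "\<beta> \<in> Field r" for \<beta>
      using t[of \<beta>] that by (simp add: P_def)
    then show "p \<beta> \<gamma> (t \<gamma> y) = t \<beta> y" if "(\<beta>, \<gamma>) \<in> r" "y \<in> topspace (Y \<alpha>)" for \<beta> \<gamma> y
      using t[of \<gamma>] that pid[of \<beta> "t \<beta> y"]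
      by (cases "\<beta> = \<gamma>") (auto simp: P_def underS_def Field_def continuous_map_def Pi_iff)
    show "t \<alpha> y = y" if "y \<in> topspace (Y \<alpha>)" for y
      using t[of \<alpha>] that \<alpha> pid REFL by (auto simp: P_def refl_on_def)
  qed
qed

lemma inverse_sequence_transfer:
  fixes r :: "'i rel" and Y :: "'i \<Rightarrow> 'b topology" and X :: "'a topology"
  assumes cont: "continuous_inverse_sequence r Y p" and ri: "right_invertible_bonding r Y p"
    and X: "X homeomorphic_space inverse_limit r (Field r) Y p"
  obtains r' :: "('a \<times> 'a) set rel" and X' :: "('a \<times> 'a) set \<Rightarrow> 'a topology" and p'
  where "continuous_inverse_sequence r' X' p'" "right_invertible_bonding r' X' p'"
    "X homeomorphic_space inverse_limit r' (Field r') X' p'"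
    "\<And>e. e \<in> Field r' \<Longrightarrow> \<exists>\<alpha> \<in> Field r. X' e homeomorphic_space Y \<alpha>"
proof -
  have iseq: "inverse_sequence r Y p" using cont by (simp add: continuous_inverse_sequence_def)
  have W: "Well_order r" using iseq by (simp add: inverse_sequence_def)
  have wo: "wo_rel r" using W by (simp add: wo_rel_def)
  note TOTALS = wo_rel.TOTALS[OF wo] and TRANS = wo_rel.TRANS[OF wo]
    and REFL = wo_rel.REFL[OF wo] and ANTISYM = wo_rel.ANTISYM[OF wo]
  have antis: "x = y" if "(x, y) \<in> r" "(y, x) \<in> r" for x y
    using ANTISYM that by (meson antisymD)
  have refl: "(x, x) \<in> r" if "x \<in> Field r" for x
    using REFL that by (meson refl_onD)
  have trns: "(x, z) \<in> r" if "(x, y) \<in> r" "(y, z) \<in> r" for x y z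
    using TRANS that by (meson transD)
  have pp: "p \<beta> \<gamma> (p \<gamma> \<delta> x) = p \<beta> \<delta> x"
    if "(\<beta>, \<gamma>) \<in> r" "(\<gamma>, \<delta>) \<in> r" "x \<in> topspace (Y \<delta>)" for \<beta> \<gamma> \<delta> x
    using iseq that unfolding inverse_sequence_def by blast
  let ?L = "inverse_limit r (Field r) Y p"
  obtain h k where hk: "homeomorphic_maps X ?L h k"
    using X unfolding homeomorphic_space_def by blast
  have hc: "continuous_map X ?L h" and kc: "continuous_map ?L X k"
    and kh: "\<And>x. x \<in> topspace X \<Longrightarrow> k (h x) = x" and hk': "\<And>y. y \<in> topspace ?L \<Longrightarrow> h (k y) = y"
    using hk by (auto simp: homeomorphic_maps_def)
  have hL: "h x \<in> topspace ?L" if "x \<in> topspace X" for x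
    using hc that by (auto simp: continuous_map_def)
  define \<pi> where "\<pi> = (\<lambda>\<alpha> x. h x \<alpha>)"
  have \<pi>c: "continuous_map X (Y \<alpha>) (\<pi> \<alpha>)" if "\<alpha> \<in> Field r" for \<alpha>
    using continuous_map_compose[OF hc continuous_map_inverse_limit_projection[OF that]]
    by (simp add: \<pi>_def o_def)
  have \<pi>Y: "\<pi> \<alpha> x \<in> topspace (Y \<alpha>)" if "\<alpha> \<in> Field r" "x \<in> topspace X" for \<alpha> x
    using \<pi>c that by (auto simp: continuous_map_def)
  have p\<pi>: "p \<alpha> \<beta> (\<pi> \<beta> x) = \<pi> \<alpha> x" if "(\<alpha>, \<beta>) \<in> r" "x \<in> topspace X" for \<alpha> \<beta> x
    using hL[OF that(2)] that(1) unfolding topspace_inverse_limit \<pi>_def by (metis FieldI1 FieldI2)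
  have "\<exists>s. continuous_map (Y \<alpha>) X s \<and> (\<forall>y\<in>topspace (Y \<alpha>). \<pi> \<alpha> (s y) = y)"
    if \<alpha>: "\<alpha> \<in> Field r" for \<alpha>
  proof -
    obtain t where t: "\<And>\<beta>. \<beta> \<in> Field r \<Longrightarrow> continuous_map (Y \<alpha>) (Y \<beta>) (t \<beta>)"
      "\<And>\<beta> \<gamma> y. \<lbrakk>(\<beta>, \<gamma>) \<in> r; y \<in> topspace (Y \<alpha>)\<rbrakk> \<Longrightarrow> p \<beta> \<gamma> (t \<gamma> y) = t \<beta> y"
      "\<And>y. y \<in> topspace (Y \<alpha>) \<Longrightarrow> t \<alpha> y = y"
      using inverse_sequence_sections[OF cont ri \<alpha>] by metis
    define v where "v = (\<lambda>y. \<lambda>\<beta>\<in>Field r. t \<beta> y)"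
    have v: "continuous_map (Y \<alpha>) ?L v"
      by (rule continuous_map_into_inverse_limit) (use t in \<open>auto simp: v_def\<close>)
    have "h (k (v y)) = v y" if "y \<in> topspace (Y \<alpha>)" for y
      using v that by (intro hk') (auto simp: continuous_map_def)
    then have "\<forall>y\<in>topspace (Y \<alpha>). \<pi> \<alpha> ((k \<circ> v) y) = y"
      using t(3) \<alpha> by (simp add: \<pi>_def v_def)
    moreover have "continuous_map (Y \<alpha>) X (k \<circ> v)"
      using v kc continuous_map_compose by blast
    ultimately show ?thesis by blast
  qed
  then obtain s where sc: "\<And>\<alpha>. \<alpha> \<in> Field r \<Longrightarrow> continuous_map (Y \<alpha>) X (s \<alpha>)"
    and \<pi>s: "\<And>\<alpha> y. \<lbrakk>\<alpha> \<in> Field r; y \<in> topspace (Y \<alpha>)\<rbrakk> \<Longrightarrow> \<pi> \<alpha> (s \<alpha> y) = y"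
    by metis
  define E where "E \<alpha> = {(x, x'). x \<in> topspace X \<and> x' \<in> topspace X \<and> \<pi> \<alpha> x = \<pi> \<alpha> x'}" for \<alpha>
  have Emono: "E \<beta> \<subseteq> E \<alpha>" if "(\<alpha>, \<beta>) \<in> r" for \<alpha> \<beta>
    using p\<pi>[OF that] unfolding E_def by (auto, metis)
  define J where "J = E ` Field r"
  define a where "a e = wo_rel.minim r {\<alpha> \<in> Field r. E \<alpha> = e}" for e
  have aF: "a e \<in> Field r" and Ea: "E (a e) = e" if "e \<in> J" for e
  proof -
    have "a e \<in> {\<alpha> \<in> Field r. E \<alpha> = e}"
      unfolding a_def by (rule wo_rel.minim_in[OF wo]) (use that in \<open>auto simp: J_def\<close>)
    then show "a e \<in> Field r" "E (a e) = e" by auto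
  qed
  have aleast: "(a (E \<alpha>), \<alpha>) \<in> r" if "\<alpha> \<in> Field r" for \<alpha>
    unfolding a_def by (rule wo_rel.minim_least[OF wo]) (use that in auto)
  have EJ: "E \<alpha> \<in> J" if "\<alpha> \<in> Field r" for \<alpha> using that by (simp add: J_def)
  define r' where "r' = {(e, e'). e \<in> J \<and> e' \<in> J \<and> e' \<subseteq> e}"
  have r'a: "(e, e') \<in> r' \<longleftrightarrow> e \<in> J \<and> e' \<in> J \<and> (a e, a e') \<in> r" for e e'
  proof
    assume L: "(e, e') \<in> r'"
    then have J: "e \<in> J" "e' \<in> J" "e' \<subseteq> e" by (auto simp: r'_def)
    consider "(a e, a e') \<in> r" | "(a e', a e) \<in> r" using TOTALS J aF by blast
    then show "e \<in> J \<and> e' \<in> J \<and> (a e, a e') \<in> r"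
    proof cases
      case 2
      then have "e \<subseteq> e'" using Emono Ea J by metis
      then have "e = e'" using J by blast
      then show ?thesis using 2 J by simp
    qed (use J in simp)
  next
    assume R: "e \<in> J \<and> e' \<in> J \<and> (a e, a e') \<in> r"
    then have "e' \<subseteq> e" using Emono Ea by metis
    then show "(e, e') \<in> r'" using R by (simp add: r'_def)
  qed
  have Fr': "Field r' = J" by (auto simp: Field_def r'_def)
  have W': "Well_order r'"
    unfolding well_order_on_def linear_order_on_def partial_order_on_def preorder_on_def Fr'
  proof (intro conjI)
    show "r' \<subseteq> J \<times> J" "refl_on J r'" "trans r'" "antisym r'"
      by (auto simp: r'_def refl_on_def trans_def antisym_def)
    show "total_on J r'" using TOTALS aF by (auto simp: total_on_def r'a)
    have "wf (inv_image (r - Id) a)" using W by (simp add: well_order_on_def wf_inv_image)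
    moreover have "r' - Id \<subseteq> inv_image (r - Id) a"
    proof clarify
      fix e e' assume e: "(e, e') \<in> r'" "(e, e') \<notin> inv_image (r - Id) a"
      then have "a e = a e'" and J: "e \<in> J" "e' \<in> J" by (auto simp: inv_image_def r'a)
      then show "e = e'" using Ea J by metis
    qed
    ultimately show "wf (r' - Id)" using wf_subset by blast
  qed
  define \<rho> where "\<rho> e = s (a e) \<circ> \<pi> (a e)" for e
  have \<rho>c: "continuous_map X X (\<rho> e)" if "e \<in> J" for e
    unfolding \<rho>_def using \<pi>c sc aF that continuous_map_compose by blast
  have \<rho>X: "\<rho> e x \<in> topspace X" if "e \<in> J" "x \<in> topspace X" for e x
    using \<rho>c that by (auto simp: continuous_map_def)
  have \<pi>\<rho>: "\<pi> \<alpha> (\<rho> e x) = \<pi> \<alpha> x" if "\<alpha> \<in> Field r" "e \<in> J" "e \<subseteq> E \<alpha>" "x \<in> topspace X" for \<alpha> e x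
  proof -
    have "\<pi> (a e) (\<rho> e x) = \<pi> (a e) x" using \<pi>s \<pi>Y aF that by (simp add: \<rho>_def)
    then have "(\<rho> e x, x) \<in> E (a e)" using that \<rho>X by (simp add: E_def)
    then show ?thesis using that Ea by (auto simp: E_def)
  qed
  have \<rho>\<rho>: "\<rho> e (\<rho> e' x) = \<rho> e x" if "(e, e') \<in> r'" "x \<in> topspace X" for e e' x
  proof -
    have "\<pi> (a e) (\<rho> e' x) = \<pi> (a e) x"
      by (rule \<pi>\<rho>) (use that aF Ea in \<open>auto simp: r'_def\<close>)
    then show ?thesis by (simp add: \<rho>_def)
  qed
  define X' where "X' e = subtopology X (\<rho> e ` topspace X)" for e
  define p' where "p' = (\<lambda>(e :: ('a \<times> 'a) set) (e' :: ('a \<times> 'a) set). \<rho> e)"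
  have X'fix: "\<rho> e x = x" if "e \<in> J" "x \<in> topspace (X' e)" for e x
    using that \<rho>\<rho>[of e e] by (auto simp: X'_def r'_def)
  have X'X: "x \<in> topspace X" if "x \<in> topspace (X' e)" for e x
    using that by (simp add: X'_def)
  have \<rho>c': "continuous_map Z (X' e) (\<rho> e)" if "e \<in> J" "Z = subtopology X S" for Z S e
    unfolding X'_def using \<rho>c[OF that(1)] that(2)
    by (auto simp: continuous_map_in_subtopology intro: continuous_map_from_subtopology)
  have homeoY: "homeomorphic_maps (X' e) (Y (a e)) (\<pi> (a e)) (s (a e))" if e: "e \<in> J" for e
    unfolding homeomorphic_maps_def
  proof (intro conjI ballI)
    show "continuous_map (X' e) (Y (a e)) (\<pi> (a e))"
      unfolding X'_def using \<pi>c aF e by (blast intro: continuous_map_from_subtopology)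
    have "s (a e) y \<in> \<rho> e ` topspace X" if y: "y \<in> topspace (Y (a e))" for y
    proof (rule image_eqI)
      show "s (a e) y = \<rho> e (s (a e) y)" using \<pi>s aF e y by (simp add: \<rho>_def)
      show "s (a e) y \<in> topspace X" using sc[OF aF[OF e]] y by (auto simp: continuous_map_def)
    qed
    then show "continuous_map (Y (a e)) (X' e) (s (a e))"
      unfolding X'_def using sc[OF aF[OF e]] by (auto simp: continuous_map_in_subtopology)
    show "s (a e) (\<pi> (a e) x) = x" if "x \<in> topspace (X' e)" for x
      using X'fix[OF e that] by (simp add: \<rho>_def)
    show "\<pi> (a e) (s (a e) y) = y" if "y \<in> topspace (Y (a e))" for y
      using \<pi>s aF e that by blast
  qed
  have limit: "homeomorphic_map Z (inverse_limit r' (E ` D) X' p') (\<lambda>x. \<lambda>e\<in>E ` D. \<rho> e x)"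
    if D: "D \<subseteq> Field r" and Z: "Z = subtopology X S"
      and hom: "homeomorphic_map Z (inverse_limit r D Y p) (\<lambda>x. \<lambda>\<alpha>\<in>D. \<pi> \<alpha> x)" for D S Z
  proof -
    let ?LD = "inverse_limit r D Y p" and ?LE = "inverse_limit r' (E ` D) X' p'"
    obtain q where q: "homeomorphic_maps Z ?LD (\<lambda>x. \<lambda>\<alpha>\<in>D. \<pi> \<alpha> x) q"
      using hom homeomorphic_map_maps by blast
    have DJ: "E ` D \<subseteq> J" using D by (auto simp: J_def)
    have ZX: "x \<in> topspace X" if "x \<in> topspace Z" for x using that Z by simp
    define w where "w = (\<lambda>z. \<lambda>\<alpha>\<in>D. \<pi> \<alpha> (z (E \<alpha>)))"
    have zX: "z e \<in> topspace (X' e)" if "z \<in> topspace ?LE" "e \<in> E ` D" for z e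
      using that by (auto simp: topspace_inverse_limit)
    have wc: "continuous_map ?LE ?LD w"
    proof (rule continuous_map_into_inverse_limit)
      fix \<alpha> assume \<alpha>: "\<alpha> \<in> D"
      have "continuous_map ?LE (X' (E \<alpha>)) (\<lambda>z. z (E \<alpha>))"
        by (rule continuous_map_inverse_limit_projection) (use \<alpha> in simp)
      moreover have "continuous_map (X' (E \<alpha>)) (Y \<alpha>) (\<pi> \<alpha>)"
        unfolding X'_def using \<pi>c \<alpha> D by (blast intro: continuous_map_from_subtopology)
      ultimately have "continuous_map ?LE (Y \<alpha>) (\<pi> \<alpha> \<circ> (\<lambda>z. z (E \<alpha>)))"
        by (rule continuous_map_compose)
      then show "continuous_map ?LE (Y \<alpha>) (\<lambda>z. w z \<alpha>)" using \<alpha> by (simp add: w_def o_def)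
    next
      fix z \<alpha> \<beta> assume z: "z \<in> topspace ?LE" and ab: "\<alpha> \<in> D" "\<beta> \<in> D" "(\<alpha>, \<beta>) \<in> r"
      have er: "(E \<alpha>, E \<beta>) \<in> r'" using Emono ab EJ D by (auto simp: r'_def)
      have zb: "z (E \<beta>) \<in> topspace X" using zX[OF z] X'X ab by blast
      have "z (E \<alpha>) = \<rho> (E \<alpha>) (z (E \<beta>))"
        using z ab er by (auto simp: topspace_inverse_limit p'_def)
      then have "\<pi> \<alpha> (z (E \<alpha>)) = \<pi> \<alpha> (z (E \<beta>))"
        using \<pi>\<rho>[of \<alpha> "E \<alpha>" "z (E \<beta>)"] zb ab D EJ by auto
      then show "p \<alpha> \<beta> (w z \<beta>) = w z \<alpha>" using p\<pi>[OF ab(3) zb] ab by (simp add: w_def)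
    qed (simp add: w_def)
    have "homeomorphic_maps Z ?LE (\<lambda>x. \<lambda>e\<in>E ` D. \<rho> e x) (q \<circ> w)"
      unfolding homeomorphic_maps_def
    proof (intro conjI ballI)
      show "continuous_map Z ?LE (\<lambda>x. \<lambda>e\<in>E ` D. \<rho> e x)"
      proof (rule continuous_map_into_inverse_limit)
        fix e assume "e \<in> E ` D"
        then show "continuous_map Z (X' e) (\<lambda>x. (\<lambda>e\<in>E ` D. \<rho> e x) e)"
          using \<rho>c' Z DJ by auto
      next
        fix x e e' assume "x \<in> topspace Z" "e \<in> E ` D" "e' \<in> E ` D" "(e, e') \<in> r'"
        then show "p' e e' ((\<lambda>e\<in>E ` D. \<rho> e x) e') = (\<lambda>e\<in>E ` D. \<rho> e x) e"
          using \<rho>\<rho> ZX by (simp add: p'_def)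
      qed simp
      show "continuous_map ?LE Z (q \<circ> w)"
        using wc q by (auto simp: homeomorphic_maps_def intro: continuous_map_compose)
    next
      fix x assume x: "x \<in> topspace Z"
      have "w (\<lambda>e\<in>E ` D. \<rho> e x) = (\<lambda>\<alpha>\<in>D. \<pi> \<alpha> x)"
        using \<pi>\<rho> ZX x D EJ by (auto simp: w_def fun_eq_iff)
      then show "(q \<circ> w) (\<lambda>e\<in>E ` D. \<rho> e x) = x"
        using q x by (simp add: homeomorphic_maps_def)
    next
      fix z assume z: "z \<in> topspace ?LE"
      define x where "x = q (w z)"
      have wz: "w z \<in> topspace ?LD" using wc z by (auto simp: continuous_map_def)
      then have xZ: "x \<in> topspace Z" and xw: "(\<lambda>\<alpha>\<in>D. \<pi> \<alpha> x) = w z"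
        using q by (auto simp: x_def homeomorphic_maps_def continuous_map_def)
      have "\<rho> e x = z e" if e: "e \<in> E ` D" for e
      proof -
        obtain \<alpha> where \<alpha>: "\<alpha> \<in> D" "e = E \<alpha>" using e by blast
        have "\<pi> \<alpha> x = \<pi> \<alpha> (z e)" using fun_cong[OF xw, of \<alpha>] \<alpha> by (simp add: w_def)
        then have "(x, z e) \<in> E (a e)"
          using \<alpha> Ea EJ D ZX[OF xZ] X'X[OF zX[OF z e]] by (auto simp: E_def)
        then have "\<rho> e x = \<rho> e (z e)" by (simp add: \<rho>_def E_def)
        then show ?thesis using X'fix zX[OF z e] e DJ by auto
      qed
      moreover have "z \<in> extensional (E ` D)" using z by (simp add: topspace_inverse_limit)
      ultimately show "(\<lambda>e\<in>E ` D. \<rho> e ((q \<circ> w) z)) = z"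
        by (auto simp: x_def fun_eq_iff extensional_def)
    qed
    then show ?thesis using homeomorphic_map_maps by blast
  qed
  have rle: "\<beta> \<in> Field r" "\<gamma> \<in> Field r" if "(\<beta>, \<gamma>) \<in> r" for \<beta> \<gamma>
    using that by (auto simp: Field_def)
  show thesis
  proof
    have "homeomorphic_map (X' e) (inverse_limit r' (underS r' e) X' p')
            (\<lambda>x. \<lambda>e'\<in>underS r' e. p' e' e x)" if e: "limit_index r' e" for e
    proof -
      let ?D = "underS r (a e)"
      have eJ: "e \<in> J" using e by (simp add: limit_index_def Fr')
      have und: "a e' \<in> ?D" if "e' \<in> underS r' e" for e'
      proof -
        have e': "e' \<noteq> e" "e' \<in> J" "(a e', a e) \<in> r" using that by (auto simp: underS_def r'a)
        then have "a e' \<noteq> a e" using Ea eJ by metis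
        then show ?thesis using e' by (simp add: underS_def)
      qed
      have und': "E \<beta> \<in> underS r' e" if "\<beta> \<in> ?D" for \<beta>
      proof -
        have b: "(\<beta>, a e) \<in> r" "\<beta> \<noteq> a e" "\<beta> \<in> Field r" using that by (auto simp: underS_def Field_def)
        have "E \<beta> \<noteq> e" using aleast[OF b(3)] b antis by auto
        moreover have "e \<subseteq> E \<beta>" using Emono[OF b(1)] Ea eJ by simp
        ultimately show ?thesis using eJ EJ b by (simp add: underS_def r'_def)
      qed
      have ED: "E ` ?D = underS r' e"
      proof
        show "underS r' e \<subseteq> E ` ?D"
        proof
          fix e' assume e': "e' \<in> underS r' e"
          then have "e' \<in> J" by (auto simp: underS_def r'_def)
          then show "e' \<in> E ` ?D" using und[OF e'] Ea by (metis image_eqI)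
        qed
      qed (use und' in blast)
      have lim: "limit_index r (a e)"
        unfolding limit_index_def
      proof (intro conjI ballI)
        show "a e \<in> Field r" using aF eJ by blast
        show "?D \<noteq> {}" using e und by (auto simp: limit_index_def)
        fix \<beta> assume \<beta>: "\<beta> \<in> ?D"
        have bF: "\<beta> \<in> Field r" using \<beta> by (auto simp: underS_def Field_def)
        obtain e' where e': "e' \<in> underS r' e" "(E \<beta>, e') \<in> r'" "E \<beta> \<noteq> e'"
          using e und'[OF \<beta>] unfolding limit_index_def by blast
        have J': "e' \<in> J" using e'(2) by (simp add: r'_def)
        have "(a e', \<beta>) \<notin> r"
        proof
          assume "(a e', \<beta>) \<in> r"
          then have "E \<beta> \<subseteq> e'" using Emono Ea J' by metis
          then show False using e' by (auto simp: r'_def)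
        qed
        then have "(\<beta>, a e') \<in> r" "\<beta> \<noteq> a e'" using TOTALS bF aF J' refl by auto
        then show "\<exists>\<gamma>\<in>?D. (\<beta>, \<gamma>) \<in> r \<and> \<beta> \<noteq> \<gamma>" using und[OF e'(1)] by blast
      qed
      have "homeomorphic_map (X' e) (Y (a e)) (\<pi> (a e))"
        using homeoY[OF eJ] homeomorphic_map_maps by blast
      moreover have "homeomorphic_map (Y (a e)) (inverse_limit r ?D Y p) (\<lambda>x. \<lambda>\<alpha>\<in>?D. p \<alpha> (a e) x)"
        using cont lim by (simp add: continuous_inverse_sequence_def)
      ultimately have "homeomorphic_map (X' e) (inverse_limit r ?D Y p)
          ((\<lambda>x. \<lambda>\<alpha>\<in>?D. p \<alpha> (a e) x) \<circ> \<pi> (a e))"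
        by (rule homeomorphic_map_compose)
      then have "homeomorphic_map (X' e) (inverse_limit r ?D Y p) (\<lambda>x. \<lambda>\<alpha>\<in>?D. \<pi> \<alpha> x)"
        by (rule homeomorphic_map_eq) (auto simp: fun_eq_iff underS_def p\<pi> dest: X'X)
      then have "homeomorphic_map (X' e) (inverse_limit r' (E ` ?D) X' p') (\<lambda>x. \<lambda>e\<in>E ` ?D. \<rho> e x)"
        by (intro limit[where S = "\<rho> e ` topspace X"]) (auto simp: X'_def underS_def Field_def)
      then show ?thesis unfolding ED by (simp add: p'_def)
    qed
    moreover have "inverse_sequence r' X' p'"
      unfolding inverse_sequence_def
    proof (intro conjI allI impI ballI)
      show "Well_order r'" by fact
      show "case x of (e, e') \<Rightarrow> continuous_map (X' e') (X' e) (p' e e')" if "x \<in> r'" for x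
        using that by (cases x) (auto simp: p'_def r'_def intro: \<rho>c'[OF _ X'_def])
      show "p' e e x = x" if "e \<in> Field r'" "x \<in> topspace (X' e)" for e x
        using that X'fix by (simp add: p'_def Fr')
      show "p' e e' (p' e' e'' x) = p' e e'' x"
        if "(e, e') \<in> r'" "(e', e'') \<in> r'" "x \<in> topspace (X' e'')" for e e' e'' x
        using that \<rho>\<rho> X'X by (simp add: p'_def)
    qed
    ultimately show "continuous_inverse_sequence r' X' p'"
      by (simp add: continuous_inverse_sequence_def)
    show "right_invertible_bonding r' X' p'"
      unfolding right_invertible_bonding_def
    proof clarify
      fix e e' assume e: "(e, e') \<in> r'"
      then have J: "e \<in> J" "e' \<in> J" by (auto simp: r'_def)
      have "retraction_maps (X' e') (X' e) (p' e e') (\<rho> e')"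
        unfolding retraction_maps_def
      proof (intro conjI ballI)
        show "continuous_map (X' e') (X' e) (p' e e')" "continuous_map (X' e) (X' e') (\<rho> e')"
          using J by (auto simp: p'_def intro: \<rho>c'[OF _ X'_def])
        show "p' e e' (\<rho> e' x) = x" if "x \<in> topspace (X' e)" for x
          using that \<rho>\<rho>[OF e X'X] X'fix J by (simp add: p'_def)
      qed
      then show "retraction_map (X' e') (X' e) (p' e e')" by (auto simp: retraction_map_def)
    qed
    have "homeomorphic_map X ?L h" using hk homeomorphic_map_maps by blast
    then have "homeomorphic_map X ?L (\<lambda>x. \<lambda>\<alpha>\<in>Field r. \<pi> \<alpha> x)"
    proof (rule homeomorphic_map_eq)
      fix x assume "x \<in> topspace X"
      then have "h x \<in> extensional (Field r)" using hL by (auto simp: topspace_inverse_limit)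
      then show "h x = (\<lambda>\<alpha>\<in>Field r. \<pi> \<alpha> x)" by (auto simp: \<pi>_def fun_eq_iff extensional_def)
    qed
    then have "homeomorphic_map X (inverse_limit r' (E ` Field r) X' p') (\<lambda>x. \<lambda>e\<in>E ` Field r. \<rho> e x)"
      using limit[of "Field r" X UNIV] by simp
    then show "X homeomorphic_space inverse_limit r' (Field r') X' p'"
      unfolding Fr' J_def homeomorphic_space by blast
    show "\<exists>\<alpha>\<in>Field r. X' e homeomorphic_space Y \<alpha>" if "e \<in> Field r'" for e
      using that homeoY aF Fr' unfolding homeomorphic_space_def by blast
  qed
qed

theorem class_R_homeomorphic:
  fixes X :: "'a topology" and Y :: "'b topology"
  assumes "class_R Y" "X homeomorphic_space Y"
  shows "class_R X"
  using assms
proof (induction arbitrary: X rule: class_R.induct)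
  case (compact_metrizable Y)
  then show ?case
    by (meson class_R.compact_metrizable homeomorphic_compact_space homeomorphic_metrizable_space)
next
  case (limit_of_sequence r Z p Y)
  have "X homeomorphic_space inverse_limit r (Field r) Z p"
    using limit_of_sequence homeomorphic_space_trans by blast
  then obtain r' :: "('a \<times> 'a) set rel" and X' :: "('a \<times> 'a) set \<Rightarrow> 'a topology" and p'
    where *: "continuous_inverse_sequence r' X' p'" "right_invertible_bonding r' X' p'"
      "X homeomorphic_space inverse_limit r' (Field r') X' p'"
      "\<And>e. e \<in> Field r' \<Longrightarrow> \<exists>\<alpha> \<in> Field r. X' e homeomorphic_space Z \<alpha>"
    using inverse_sequence_transfer[OF limit_of_sequence(1,2)] by metis
  then have "\<forall>e \<in> Field r'. class_R (X' e)" using limit_of_sequence by blast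
  then show ?case using * class_R.limit_of_sequence by blast
qed

theorem class_R_inverse_limit:
  fixes r :: "'i rel" and Y :: "'i \<Rightarrow> 'b topology" and X :: "'a topology"
  assumes "continuous_inverse_sequence r Y p" "right_invertible_bonding r Y p"
    and "\<forall>\<alpha> \<in> Field r. class_R (Y \<alpha>)"
    and "X homeomorphic_space inverse_limit r (Field r) Y p"
  shows "class_R X"
proof -
  obtain r' :: "('a \<times> 'a) set rel" and X' :: "('a \<times> 'a) set \<Rightarrow> 'a topology" and p'
    where *: "continuous_inverse_sequence r' X' p'" "right_invertible_bonding r' X' p'"
      "X homeomorphic_space inverse_limit r' (Field r') X' p'"
      "\<And>e. e \<in> Field r' \<Longrightarrow> \<exists>\<alpha> \<in> Field r. X' e homeomorphic_space Y \<alpha>"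
    using inverse_sequence_transfer[OF assms(1,2,4)] by metis
  then have "\<forall>e \<in> Field r'. class_R (X' e)" using assms class_R_homeomorphic by blast
  then show ?thesis using * class_R.limit_of_sequence by blast
qed

end

theory Submission
  imports Defs "HOL-Library.Countable_Set_Type"
begin

text \<open>
  The group consists of the families \<open>(z, (w\<^sub>j\<^sub>,\<^sub>n))\<close> of complex numbers of modulus 1, where \<open>j\<close>
  ranges over a set \<open>J\<close> of \<open>\<omega>\<^sub>1\<close> subsets of \<open>\<nat>\<close> and \<open>n\<close> over \<open>\<nat>\<close>, with
  \<open>w\<^sub>j\<^sub>,\<^sub>n = z w\<^sub>j\<^sub>,\<^sub>n\<^sub>+\<^sub>1\<^sup>2\<close> if \<open>n \<in> j\<close> and \<open>w\<^sub>j\<^sub>,\<^sub>n = w\<^sub>j\<^sub>,\<^sub>n\<^sub>+\<^sub>1\<^sup>2\<close> otherwise. Formally \<open>w\<^sub>j\<^sub>,\<^sub>0\<close> is \<open>z\<close> to the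
  power of the 2-adic integer whose binary digits are given by \<open>j\<close>; the dual group is an
  extension of a direct sum of \<open>\<omega>\<^sub>1\<close> copies of \<open>\<int>[1/2]\<close> by \<open>\<int>\<close>.

  Call such a family of continuous functions \<open>w\<^sub>j\<^sub>,\<^sub>n\<close> on a compact space \<open>X\<close> a dyadic expansion
  of \<open>z : X \<rightarrow> S\<^sup>1\<close> along \<open>j\<close>, and call \<open>z\<close> twisted if it has expansions along uncountably many
  \<open>j\<close> and yet no continuous square root. The coordinate \<open>z\<close> of the group is twisted: a square root
  would be determined by finitely many coordinates, and along a suitable one-parameter arc all
  these coordinates close up while \<open>z\<close> winds once around the circle
  (\<open>no_square_root_dyadic_tower\<close>).

  On a second countable compact space nothing is twisted (\<open>second_countable_not_twisted\<close>). Two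
  of uncountably many functions \<open>w\<^sub>j\<^sub>,\<^sub>0\<close> are uniformly close, hence their quotient is homotopic
  to a constant. If \<open>k\<close> is the first digit in which the two sets differ, then the quotient is the
  \<open>2\<^sup>k\<close>-th power of \<open>z v\<^sup>2\<close> (or its inverse) for a continuous \<open>v\<close>, and so \<open>z\<close> has a square root.

  Twistedness descends along approximate factorisations (\<open>twisted_approximate_factor\<close>): if
  \<open>p : X \<rightarrow> Y\<close> and \<open>s : Y \<rightarrow> X\<close> are such that \<open>z \<circ> s \<circ> p\<close> is uniformly close to \<open>z\<close>, then
  \<open>z \<circ> s\<close> is twisted on \<open>Y\<close>. For the limit of a sequence with right-invertible bonding maps, \<open>z\<close>
  nearly factors through some \<open>Y\<^sub>\<alpha>\<close>, and a section of the projection to \<open>Y\<^sub>\<alpha>\<close> serves as \<open>s\<close>; by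
  induction no space in the class R is twisted. A Valdivia compact space has enough retractions
  \<open>x \<mapsto> x \<cdot> 1\<^sub>S\<close> with \<open>S\<close> countable, whose images are second countable, and the same lemma applies.
  The group is therefore outside both classes, and since it is compact and not second countable
  its weight is exactly \<open>\<omega>\<^sub>1\<close>.
\<close>

section \<open>Continuous functions on compact spaces\<close>

lemma continuous_map_complex_mult:
  fixes f g :: "'a \<Rightarrow> complex"
  assumes "continuous_map X euclidean f" "continuous_map X euclidean g"
  shows "continuous_map X euclidean (\<lambda>x. f x * g x)"
  using assms by (simp add: continuous_map_atin tendsto_mult)

lemma continuous_map_complex_divide:
  fixes f g :: "'a \<Rightarrow> complex"
  assumes "continuous_map X euclidean f" "continuous_map X euclidean g"
    and "\<And>x. x \<in> topspace X \<Longrightarrow> g x \<noteq> 0"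
  shows "continuous_map X euclidean (\<lambda>x. f x / g x)"
  using assms by (simp add: continuous_map_atin tendsto_divide)

lemma continuous_map_compose_on:
  fixes f :: "'a \<Rightarrow> complex" and g :: "complex \<Rightarrow> complex"
  assumes "continuous_map X euclidean f" "continuous_on S g" "f ` topspace X \<subseteq> S"
  shows "continuous_map X euclidean (\<lambda>x. g (f x))"
proof -
  have "continuous_map X (top_of_set S) f"
    using assms by (simp add: continuous_map_in_subtopology image_subset_iff_funcset)
  moreover have "continuous_map (top_of_set S) euclidean g" using assms by simp
  ultimately have "continuous_map X euclidean (g \<circ> f)" by (rule continuous_map_compose)
  then show ?thesis by (simp add: o_def)
qed

lemma compact_metrizable_imp_second_countable:
  assumes "compact_space X" "metrizable_space X"
  shows "second_countable X"
proof -
  obtain M d where "Metric_space M d" and X: "X = Metric_space.mtopology M d"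
    using assms(2) by (auto simp: metrizable_space_def)
  then interpret Metric_space M d by simp
  have "mtotally_bounded M"
    using assms(1) compactin_imp_mtotally_bounded unfolding X compact_space_def by simp
  then have "\<forall>n. \<exists>K. finite K \<and> K \<subseteq> M \<and> M \<subseteq> (\<Union>x\<in>K. mball x (1 / Suc n))"
    unfolding mtotally_bounded_def by simp
  then obtain K where K: "\<And>n. finite (K n)" "\<And>n. K n \<subseteq> M"
      "\<And>n. M \<subseteq> (\<Union>x\<in>K n. mball x (1 / Suc n))"
    by metis
  define \<B> where "\<B> = (\<Union>n. (\<lambda>x. mball x (1 / Suc n)) ` K n)"
  have "countable \<B>"
    unfolding \<B>_def by (intro countable_UN countable_image countable_finite K countableI_type)
  moreover have "\<forall>V\<in>\<B>. openin X V" by (auto simp: \<B>_def X)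
  moreover have "\<exists>V\<in>\<B>. x \<in> V \<and> V \<subseteq> U" if U: "openin X U" "x \<in> U" for U x
  proof -
    obtain e where e: "e > 0" "mball x e \<subseteq> U" and xM: "x \<in> M"
      using U unfolding X openin_mtopology by blast
    obtain n where n: "1 / Suc n < e / 2" using e(1) by (meson half_gt_zero nat_approx_posE)
    obtain c where c: "c \<in> K n" "x \<in> mball c (1 / Suc n)" using K(3) xM by blast
    have "mball c (1 / Suc n) \<subseteq> mball x e"
    proof
      fix y assume y: "y \<in> mball c (1 / Suc n)"
      then have "d x y \<le> d x c + d c y" using c by (intro triangle) auto
      moreover have "d x c < 1 / Suc n" "d c y < 1 / Suc n" using c y commute by auto
      ultimately have "d x y < e" using n by linarith
      then show "y \<in> mball x e" using xM y by simp
    qed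
    then show ?thesis using c e unfolding \<B>_def by blast
  qed
  ultimately show ?thesis unfolding second_countable_def by blast
qed

text \<open>This is the separability of the function space in the uniform metric. Up to an error \<open>e/2\<close>, a
  function is described by a finite cover by members of a countable base together with, for each
  of them, a value in a countable dense subset of the plane; there are only countably many such
  descriptions, so two of the functions share one.\<close>

lemma uncountable_family_uniformly_close_pair:
  fixes f :: "'j \<Rightarrow> 'a \<Rightarrow> complex"
  assumes X: "compact_space X" "second_countable X" and J: "uncountable J" and e: "e > 0"
    and f: "\<And>j. j \<in> J \<Longrightarrow> continuous_map X euclidean (f j)"
  obtains i j where "i \<in> J" "j \<in> J" "i \<noteq> j" "\<And>x. x \<in> topspace X \<Longrightarrow> dist (f i x) (f j x) < e"
proof -
  obtain \<B> where \<B>: "countable \<B>" "\<And>V. V \<in> \<B> \<Longrightarrow> openin X V"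
      "\<And>U x. \<lbrakk>openin X U; x \<in> U\<rbrakk> \<Longrightarrow> \<exists>V\<in>\<B>. x \<in> V \<and> V \<subseteq> U"
    using X(2) unfolding second_countable_def by metis
  obtain D :: "complex set" where D: "countable D" "\<And>U. open U \<Longrightarrow> U \<noteq> {} \<Longrightarrow> \<exists>c\<in>D. c \<in> U"
    using countable_dense_setE by metis
  define good where "good j P \<longleftrightarrow> finite P \<and> P \<subseteq> \<B> \<times> D \<and> topspace X \<subseteq> \<Union> (fst ` P) \<and>
      (\<forall>(V, c) \<in> P. \<forall>x\<in>V. dist (f j x) c < e / 2)" for j P
  have "\<exists>P. good j P" if j: "j \<in> J" for j
  proof -
    define \<U> where "\<U> = {V \<in> \<B>. \<exists>c\<in>D. \<forall>x\<in>V. dist (f j x) c < e / 2}"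
    have "topspace X \<subseteq> \<Union>\<U>"
    proof
      fix x assume x: "x \<in> topspace X"
      obtain c where c: "c \<in> D" "c \<in> ball (f j x) (e / 2)"
        using D(2)[of "ball (f j x) (e / 2)"] e by auto
      have "openin X {y \<in> topspace X. f j y \<in> ball c (e / 2)}"
        using f[OF j] by (rule openin_continuous_map_preimage) simp
      moreover have "x \<in> {y \<in> topspace X. f j y \<in> ball c (e / 2)}"
        using x c by (simp add: dist_commute)
      ultimately obtain V where "V \<in> \<B>" "x \<in> V" "V \<subseteq> {y \<in> topspace X. f j y \<in> ball c (e / 2)}"
        using \<B>(3) by blast
      moreover from this have "dist (f j y) c < e / 2" if "y \<in> V" for y
      proof -
        have "f j y \<in> ball c (e / 2)" using \<open>V \<subseteq> _\<close> that by blast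
        then show ?thesis by (simp add: dist_commute)
      qed
      ultimately have "V \<in> \<U>"
        unfolding \<U>_def using c(1) by (intro CollectI conjI bexI[of _ c] ballI)
      then show "x \<in> \<Union>\<U>" using \<open>x \<in> V\<close> by (rule UnionI)
    qed
    then obtain \<F> where \<F>: "finite \<F>" "\<F> \<subseteq> \<U>" "topspace X \<subseteq> \<Union>\<F>"
      using X(1) \<B>(2) unfolding compact_space_alt \<U>_def by (metis (no_types, lifting) mem_Collect_eq)
    have "\<forall>V\<in>\<F>. \<exists>c. c \<in> D \<and> (\<forall>x\<in>V. dist (f j x) c < e / 2)"
      using \<F>(2) unfolding \<U>_def by blast
    from bchoice[OF this]
    obtain c where c: "\<And>V. V \<in> \<F> \<Longrightarrow> c V \<in> D \<and> (\<forall>x\<in>V. dist (f j x) (c V) < e / 2)"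
      by blast
    have "good j ((\<lambda>V. (V, c V)) ` \<F>)"
      using \<F> c unfolding good_def by (auto simp: \<U>_def image_image)
    then show ?thesis ..
  qed
  then obtain P where P: "\<And>j. j \<in> J \<Longrightarrow> good j (P j)" by metis
  have "P ` J \<subseteq> {Q. finite Q \<and> Q \<subseteq> \<B> \<times> D}" using P unfolding good_def by blast
  then have "countable (P ` J)"
    by (rule countable_subset) (intro countable_Collect_finite_subset countable_SIGMA \<B>(1) D(1))
  then have "\<not> inj_on P J" using J countable_image_inj_on by blast
  then obtain i j where ij: "i \<in> J" "j \<in> J" "i \<noteq> j" "P i = P j" by (auto simp: inj_on_def)
  show thesis
  proof
    fix x assume x: "x \<in> topspace X"
    obtain V c where V: "(V, c) \<in> P i" "x \<in> V" using P[OF ij(1)] x by (force simp: good_def)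
    have "dist (f i x) c < e / 2" using P[OF ij(1)] V by (auto simp: good_def)
    moreover have "dist (f j x) c < e / 2" using P[OF ij(2)] V ij(4) by (auto simp: good_def)
    ultimately show "dist (f i x) (f j x) < e" by (metis dist_commute dist_triangle_half_l)
  qed (use ij in auto)
qed

section \<open>Square roots and dyadic expansions\<close>

definition has_square_root :: "'a topology \<Rightarrow> ('a \<Rightarrow> complex) \<Rightarrow> bool" where
  "has_square_root X z \<longleftrightarrow> (\<exists>q. continuous_map X euclidean q \<and> (\<forall>x\<in>topspace X. z x = (q x)\<^sup>2))"

text \<open>Solving the recursion expresses \<open>w 0\<close> as the product of \<open>z ^ m\<close> and \<open>w n ^ (2 ^ n)\<close>, where \<open>m\<close> is the
  number with binary digits \<open>j \<inter> {..<n}\<close>: the functions behave like powers of \<open>z\<close> with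
  exponents the 2-adic integer \<open>j\<close> and its shifts.\<close>

definition dyadic_expansion :: "'a topology \<Rightarrow> ('a \<Rightarrow> complex) \<Rightarrow> nat set \<Rightarrow> (nat \<Rightarrow> 'a \<Rightarrow> complex) \<Rightarrow> bool"
  where "dyadic_expansion X z j w \<longleftrightarrow>
    (\<forall>n. continuous_map X euclidean (w n) \<and>
      (\<forall>x\<in>topspace X. norm (w n x) = 1 \<and> w n x = (if n \<in> j then z x else 1) * (w (Suc n) x)\<^sup>2))"

text \<open>The obstruction to membership in the class R and to being Valdivia compact: \<open>z\<close> is
  indivisible by 2 in the group of homotopy classes of maps to the circle, but has roots along
  more 2-adic directions than a metrizable compact space can carry. Asking for exact
  rather than homotopical square roots makes no difference, since a null-homotopic
  map to the circle has a continuous square root.\<close>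

definition twisted :: "'a topology \<Rightarrow> ('a \<Rightarrow> complex) \<Rightarrow> bool" where
  "twisted X z \<longleftrightarrow> compact_space X \<and> continuous_map X euclidean z \<and>
     (\<forall>x\<in>topspace X. norm (z x) = 1) \<and> \<not> has_square_root X z \<and>
     uncountable {j. \<exists>w. dyadic_expansion X z j w}"

lemma Re_pos_if_near_1:
  assumes "norm (u - 1) < 1"
  shows "0 < Re u"
  using complex_Re_le_cmod[of "1 - u"] assms by (simp add: norm_minus_commute)

lemma has_square_root_near_1:
  assumes u: "continuous_map X euclidean u" and near: "\<And>x. x \<in> topspace X \<Longrightarrow> norm (u x - 1) < 1"
  shows "has_square_root X u"
proof -
  have "u ` topspace X \<subseteq> - \<real>\<^sub>\<le>\<^sub>0"
    using Re_pos_if_near_1[OF near] by (force simp: complex_nonpos_Reals_iff)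
  then have "continuous_map X euclidean (\<lambda>x. csqrt (u x))"
    by (rule continuous_map_compose_on[OF u continuous_on_csqrt])
  then show ?thesis unfolding has_square_root_def by (metis power2_csqrt)
qed

lemma has_square_root_mult:
  assumes "has_square_root X f" "has_square_root X g"
  shows "has_square_root X (\<lambda>x. f x * g x)"
proof -
  obtain p q where "continuous_map X euclidean p" "\<forall>x\<in>topspace X. f x = (p x)\<^sup>2"
      "continuous_map X euclidean q" "\<forall>x\<in>topspace X. g x = (q x)\<^sup>2"
    using assms unfolding has_square_root_def by blast
  then show ?thesis unfolding has_square_root_def
    by (intro exI[of _ "\<lambda>x. p x * q x"]) (simp add: continuous_map_complex_mult power_mult_distrib)
qed

lemma has_square_root_divide_square:
  assumes "has_square_root X (\<lambda>x. f x * (v x)\<^sup>2)" "continuous_map X euclidean v"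
    and v: "\<And>x. x \<in> topspace X \<Longrightarrow> v x \<noteq> 0"
  shows "has_square_root X f"
proof -
  obtain q where "continuous_map X euclidean q" "\<forall>x\<in>topspace X. f x * (v x)\<^sup>2 = (q x)\<^sup>2"
    using assms(1) unfolding has_square_root_def by blast
  then show ?thesis unfolding has_square_root_def using v assms(2)
    by (intro exI[of _ "\<lambda>x. q x / v x"])
      (auto simp: continuous_map_complex_divide power_divide field_simps)
qed

text \<open>Since \<open>g ^ N\<close> stays near 1, its principal \<open>N\<close>-th root \<open>\<rho>\<close> is continuous and has a square root.
  The quotient
  \<open>g / \<rho>\<close> takes values in the finite set of \<open>N\<close>-th roots of unity, on which every function is
  continuous, so any choice of square roots will do there; \<open>X\<close> may be disconnected.\<close>

lemma has_square_root_if_power_near_1: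
  assumes g: "continuous_map X euclidean g" and N: "N > 0"
    and near: "\<And>x. x \<in> topspace X \<Longrightarrow> norm (g x ^ N - 1) < 1"
  shows "has_square_root X g"
proof -
  define \<rho> where "\<rho> x = exp (Ln (g x ^ N) / of_nat N)" for x
  have gN: "g x ^ N \<noteq> 0" "g x ^ N \<in> - \<real>\<^sub>\<le>\<^sub>0" if "x \<in> topspace X" for x
    using Re_pos_if_near_1[OF near[OF that]] complex_nonpos_Reals_iff[of "g x ^ N"] by force+
  have cpow: "continuous_map X euclidean (\<lambda>x. g x ^ N)"
    by (rule continuous_map_compose_on[OF g, of UNIV "\<lambda>t. t ^ N"]) (auto intro!: continuous_intros)
  have cL: "continuous_map X euclidean (\<lambda>x. Ln (g x ^ N))"
    by (rule continuous_map_compose_on[OF cpow, of "- \<real>\<^sub>\<le>\<^sub>0" Ln])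
      (use gN in \<open>auto intro!: continuous_intros\<close>)
  have c: "continuous_map X euclidean (\<lambda>x. exp (Ln (g x ^ N) / a))" for a
    by (rule continuous_map_compose_on[OF cL, of UNIV "\<lambda>t. exp (t / a)"])
      (cases "a = 0"; auto intro!: continuous_intros)+
  have c\<rho>: "continuous_map X euclidean \<rho>" unfolding \<rho>_def by (rule c)
  have \<rho>0: "\<rho> x \<noteq> 0" for x by (simp add: \<rho>_def)
  have \<rho>N: "\<rho> x ^ N = g x ^ N" if "x \<in> topspace X" for x
  proof -
    have "\<rho> x ^ N = exp (Ln (g x ^ N))" using N by (simp add: \<rho>_def flip: exp_of_nat_mult)
    then show ?thesis using gN[OF that] by simp
  qed
  have "has_square_root X \<rho>" unfolding has_square_root_def
  proof (intro exI conjI ballI)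
    show "continuous_map X euclidean (\<lambda>x. exp (Ln (g x ^ N) / (2 * of_nat N)))" by (rule c)
    show "\<rho> x = (exp (Ln (g x ^ N) / (2 * of_nat N)))\<^sup>2" for x
      by (simp add: \<rho>_def flip: exp_double)
  qed
  moreover have "has_square_root X (\<lambda>x. g x / \<rho> x)"
  proof -
    let ?R = "{t :: complex. t ^ N = 1}"
    have "finite ?R" using finite_roots_unity[of N] N by simp
    then have "continuous_on ?R csqrt" by (rule continuous_on_finite)
    moreover have "continuous_map X euclidean (\<lambda>x. g x / \<rho> x)"
      using g c\<rho> \<rho>0 by (intro continuous_map_complex_divide) auto
    moreover have "(\<lambda>x. g x / \<rho> x) ` topspace X \<subseteq> ?R"
    proof clarify
      fix x assume x: "x \<in> topspace X"
      show "(g x / \<rho> x) ^ N = 1" using \<rho>N[OF x] gN(1)[OF x] by (simp add: power_divide)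
    qed
    ultimately have "continuous_map X euclidean (\<lambda>x. csqrt (g x / \<rho> x))"
      using continuous_map_compose_on by blast
    then show ?thesis unfolding has_square_root_def by (metis power2_csqrt)
  qed
  ultimately have "has_square_root X (\<lambda>x. \<rho> x * (g x / \<rho> x))" by (rule has_square_root_mult)
  then show ?thesis using \<rho>0 by simp
qed

lemma dyadic_expansion_quotient:
  assumes "dyadic_expansion X z i w" "dyadic_expansion X z j v"
    and "\<And>k. k < n \<Longrightarrow> k \<in> i \<longleftrightarrow> k \<in> j" and x: "x \<in> topspace X" and z: "z x \<noteq> 0"
  shows "w 0 x / v 0 x = (w n x / v n x) ^ (2 ^ n)"
  using assms(3)
proof (induction n)
  case (Suc n)
  have "w n x = (if n \<in> i then z x else 1) * (w (Suc n) x)\<^sup>2"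
       "v n x = (if n \<in> j then z x else 1) * (v (Suc n) x)\<^sup>2"
    using assms(1,2) x unfolding dyadic_expansion_def by blast+
  then have "w n x / v n x = (w (Suc n) x / v (Suc n) x)\<^sup>2"
    using Suc.prems[of n] z by (simp add: power_divide)
  then show ?case using Suc by (simp flip: power_mult)
qed simp

text \<open>Take two indices whose functions \<open>w 0\<close> are uniformly close, and the first digit \<open>k\<close> in which
  they differ. All digits before \<open>k\<close> cancel in the quotient, so \<open>w 0 / w' 0\<close> is the
  \<open>2 ^ k\<close>-th power of \<open>w k / w' k\<close>, and digit \<open>k\<close> makes the latter equal to \<open>z\<close> times a square.\<close>

theorem second_countable_not_twisted:
  assumes "second_countable X"
  shows "\<not> twisted X z"
proof
  assume tw: "twisted X z"
  let ?J = "{j. \<exists>w. dyadic_expansion X z j w}"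
  have z1: "norm (z x) = 1" if "x \<in> topspace X" for x using tw that by (simp add: twisted_def)
  have "\<forall>j\<in>?J. \<exists>w. dyadic_expansion X z j w" by blast
  from bchoice[OF this] obtain w where w: "\<And>j. j \<in> ?J \<Longrightarrow> dyadic_expansion X z j (w j)"
    by blast
  have w1: "norm (w j n x) = 1" if "j \<in> ?J" "x \<in> topspace X" for j n x
    using w that unfolding dyadic_expansion_def by blast
  have wc: "continuous_map X euclidean (w j n)" if "j \<in> ?J" for j n
    using w that unfolding dyadic_expansion_def by blast
  have X: "compact_space X" and J: "uncountable ?J" using tw by (simp_all add: twisted_def)
  obtain i0 j0 where ij0: "i0 \<in> ?J" "j0 \<in> ?J" "i0 \<noteq> j0"
      "\<And>x. x \<in> topspace X \<Longrightarrow> dist (w i0 0 x) (w j0 0 x) < 1"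
  proof (rule uncountable_family_uniformly_close_pair[of X ?J 1 "\<lambda>j. w j 0"])
    show "continuous_map X euclidean (w j 0)" if "j \<in> ?J" for j using wc that .
  qed (use X assms J in simp_all)
  define k where "k = (LEAST k. (k \<in> i0) \<noteq> (k \<in> j0))"
  have "\<exists>k. (k \<in> i0) \<noteq> (k \<in> j0)" using ij0(3) by blast
  then have k0: "(k \<in> i0) \<noteq> (k \<in> j0)" unfolding k_def by (rule LeastI_ex)
  have below0: "l \<in> i0 \<longleftrightarrow> l \<in> j0" if "l < k" for l
    using not_less_Least that unfolding k_def by blast
  \<comment> \<open>Name the two sets so that the digit \<open>k\<close> belongs to the first one.\<close>
  obtain i j where i: "i \<in> ?J" and j: "j \<in> ?J" and k: "k \<in> i" "k \<notin> j"
      and below: "\<And>l. l < k \<Longrightarrow> l \<in> i \<longleftrightarrow> l \<in> j"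
      and close: "\<And>x. x \<in> topspace X \<Longrightarrow> dist (w i 0 x) (w j 0 x) < 1"
  proof (cases "k \<in> i0")
    case True
    then show thesis using that[of i0 j0] ij0 k0 below0 by blast
  next
    case False
    then show thesis using that[of j0 i0] ij0 k0 below0 by (metis dist_commute)
  qed
  define v where "v x = w i (Suc k) x / w j (Suc k) x" for x
  have nz: "w j n x \<noteq> 0" "w i n x \<noteq> 0" if "x \<in> topspace X" for n x
    using w1[OF i that, of n] w1[OF j that, of n] by auto
  have vc: "continuous_map X euclidean v"
    unfolding v_def by (intro continuous_map_complex_divide wc i j nz)
  have "has_square_root X (\<lambda>x. w i k x / w j k x)"
  proof (rule has_square_root_if_power_near_1)
    show "continuous_map X euclidean (\<lambda>x. w i k x / w j k x)"
      by (intro continuous_map_complex_divide wc i j nz)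
    fix x assume x: "x \<in> topspace X"
    have "z x \<noteq> 0" using z1[OF x] by auto
    then have "(w i k x / w j k x) ^ (2 ^ k) = w i 0 x / w j 0 x"
      using dyadic_expansion_quotient[OF w[OF i] w[OF j] below x] by simp
    moreover have "w i 0 x / w j 0 x - 1 = (w i 0 x - w j 0 x) / w j 0 x"
      using nz(1)[OF x, of 0] by (simp add: field_simps)
    ultimately show "norm ((w i k x / w j k x) ^ (2 ^ k) - 1) < 1"
      using close[OF x] w1[OF j x, of 0] by (simp add: norm_divide dist_norm)
  qed simp
  moreover have "w i k x / w j k x = z x * (v x)\<^sup>2" if x: "x \<in> topspace X" for x
  proof -
    have "w i k x = (if k \<in> i then z x else 1) * (w i (Suc k) x)\<^sup>2"
      "w j k x = (if k \<in> j then z x else 1) * (w j (Suc k) x)\<^sup>2"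
      using w[OF i] w[OF j] x unfolding dyadic_expansion_def by blast+
    then show ?thesis using k by (simp add: v_def power_divide)
  qed
  ultimately have "has_square_root X (\<lambda>x. z x * (v x)\<^sup>2)" by (simp add: has_square_root_def)
  then have "has_square_root X z"
  proof (rule has_square_root_divide_square)
    show "v x \<noteq> 0" if "x \<in> topspace X" for x using nz[OF that] by (simp add: v_def)
  qed (rule vc)
  then show False using tw by (simp add: twisted_def)
qed

text \<open>Expansions of \<open>z\<close> pull back along \<open>s\<close>. A square root of \<open>z \<circ> s\<close> pulls back along \<open>p\<close> to one of
  \<open>z \<circ> s \<circ> p\<close>, and \<open>z / (z \<circ> s \<circ> p)\<close>, being close to 1, has one as well.\<close>

lemma twisted_approximate_factor:
  assumes tw: "twisted X z" and Y: "compact_space Y"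
    and p: "continuous_map X Y p" and s: "continuous_map Y X s"
    and near: "\<And>x. x \<in> topspace X \<Longrightarrow> dist (z (s (p x))) (z x) < 1"
  shows "twisted Y (\<lambda>y. z (s y))"
proof -
  have sX: "s y \<in> topspace X" if "y \<in> topspace Y" for y using s that by (auto simp: continuous_map_def)
  have pY: "p x \<in> topspace Y" if "x \<in> topspace X" for x using p that by (auto simp: continuous_map_def)
  have z: "continuous_map X euclidean z" "\<And>x. x \<in> topspace X \<Longrightarrow> norm (z x) = 1"
    using tw by (auto simp: twisted_def)
  have cs: "continuous_map Y euclidean (\<lambda>y. f (s y))" if "continuous_map X euclidean f" for f :: "_ \<Rightarrow> complex"
    using continuous_map_compose[OF s that] by (simp add: o_def)
  have exp: "dyadic_expansion Y (\<lambda>y. z (s y)) j (\<lambda>n y. w n (s y))" if "dyadic_expansion X z j w" for j w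
    using that cs sX unfolding dyadic_expansion_def by blast
  have "{j. \<exists>w. dyadic_expansion X z j w} \<subseteq> {j. \<exists>w. dyadic_expansion Y (\<lambda>y. z (s y)) j w}"
    using exp by blast
  moreover have "uncountable {j. \<exists>w. dyadic_expansion X z j w}" using tw by (simp add: twisted_def)
  ultimately have "uncountable {j. \<exists>w. dyadic_expansion Y (\<lambda>y. z (s y)) j w}"
    using countable_subset by blast
  moreover have "\<not> has_square_root Y (\<lambda>y. z (s y))"
  proof
    assume "has_square_root Y (\<lambda>y. z (s y))"
    then obtain q where q: "continuous_map Y euclidean q" "\<And>y. y \<in> topspace Y \<Longrightarrow> z (s y) = (q y)\<^sup>2"
      unfolding has_square_root_def by blast
    have cq: "continuous_map X euclidean (\<lambda>x. q (p x))"
      using continuous_map_compose[OF p q(1)] by (simp add: o_def)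
    then have "has_square_root X (\<lambda>x. z (s (p x)))"
      unfolding has_square_root_def using q(2) pY by blast
    moreover have "has_square_root X (\<lambda>x. z x / z (s (p x)))"
    proof (rule has_square_root_near_1)
      show "continuous_map X euclidean (\<lambda>x. z x / z (s (p x)))"
      proof (rule continuous_map_complex_divide)
        show "continuous_map X euclidean (\<lambda>x. z (s (p x)))"
          using continuous_map_compose[OF p cs[OF z(1)]] by (simp add: o_def)
      qed (use z sX pY in force)+
      fix x assume x: "x \<in> topspace X"
      have 1: "norm (z (s (p x))) = 1" using z(2) sX pY x by blast
      then have "z x / z (s (p x)) - 1 = (z x - z (s (p x))) / z (s (p x))"
        by (auto simp: diff_divide_distrib)
      then show "norm (z x / z (s (p x)) - 1) < 1"
        using near[OF x] 1 by (simp add: norm_divide dist_norm norm_minus_commute)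
    qed
    ultimately have "has_square_root X (\<lambda>x. z (s (p x)) * (z x / z (s (p x))))"
      by (rule has_square_root_mult)
    moreover have "z (s (p x)) * (z x / z (s (p x))) = z x" if "x \<in> topspace X" for x
      using z(2)[OF sX[OF pY[OF that]]] by auto
    ultimately have "has_square_root X z" by (simp add: has_square_root_def)
    then show False using tw by (simp add: twisted_def)
  qed
  ultimately show ?thesis unfolding twisted_def using Y cs[OF z(1)] z(2) sX by blast
qed

section \<open>Limits with right-invertible bonding maps\<close>

text \<open>Every point has a neighbourhood, cut out by conditions on finitely many coordinates, on which
  \<open>z\<close> varies by less than \<open>e\<close>; finitely many of these neighbourhoods cover.\<close>

lemma compact_subproduct_finite_dependence:
  fixes z :: "('i \<Rightarrow> 'b) \<Rightarrow> 'c::metric_space"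
  assumes C: "compact_space (subtopology (product_topology X I) C)"
    and z: "continuous_map (subtopology (product_topology X I) C) euclidean z" and e: "e > 0"
  obtains F where "finite F" "F \<subseteq> I"
    "\<forall>x\<in>topspace (subtopology (product_topology X I) C).
      \<forall>y\<in>topspace (subtopology (product_topology X I) C).
        (\<forall>i\<in>F. x i = y i) \<longrightarrow> dist (z x) (z y) < e"
proof -
  let ?P = "product_topology X I"
  let ?S = "subtopology ?P C"
  define controls where "controls F W \<longleftrightarrow> finite F \<and> F \<subseteq> I \<and>
    (\<exists>c. \<forall>x\<in>W. dist (z x) c < e / 2) \<and>
    (\<forall>x\<in>W. \<forall>y\<in>topspace ?S. (\<forall>i\<in>F. x i = y i) \<longrightarrow> y \<in> W)" for F W
  define \<U> where "\<U> = {W. openin ?S W \<and> (\<exists>F. controls F W)}"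
  have "topspace ?S \<subseteq> \<Union>\<U>"
  proof
    fix x assume x: "x \<in> topspace ?S"
    have "openin ?S {y \<in> topspace ?S. z y \<in> ball (z x) (e / 2)}"
      using z by (rule openin_continuous_map_preimage) simp
    then obtain T where T: "openin ?P T" "{y \<in> topspace ?S. z y \<in> ball (z x) (e / 2)} = T \<inter> C"
      unfolding openin_subtopology by blast
    have "x \<in> T" using x e T(2) by auto
    then obtain U where U: "finite {i \<in> I. U i \<noteq> topspace (X i)}"
        "\<forall>i\<in>I. openin (X i) (U i)" "x \<in> Pi\<^sub>E I U" "Pi\<^sub>E I U \<subseteq> T"
      using T(1) unfolding openin_product_topology_alt by blast
    let ?F = "{i \<in> I. U i \<noteq> topspace (X i)}"
    let ?W = "Pi\<^sub>E I U \<inter> C"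
    have "openin ?P (Pi\<^sub>E I U)" using U(1,2) by (simp add: openin_PiE_gen)
    then have "openin ?S ?W" by (simp add: openin_subtopology_Int)
    have "\<forall>y\<in>?W. dist (z y) (z x) < e / 2"
    proof
      fix y assume "y \<in> ?W"
      then have "z y \<in> ball (z x) (e / 2)" using U(4) T(2) by blast
      then show "dist (z y) (z x) < e / 2" by (simp add: dist_commute)
    qed
    moreover have "\<forall>v\<in>?W. \<forall>y\<in>topspace ?S. (\<forall>i\<in>?F. v i = y i) \<longrightarrow> y \<in> ?W"
    proof (intro ballI impI)
      fix v y assume v: "v \<in> ?W" and y: "y \<in> topspace ?S" and eq: "\<forall>i\<in>?F. v i = y i"
      have "y i \<in> U i" if i: "i \<in> I" for i
      proof (cases "i \<in> ?F")
        case True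
        moreover have "v i \<in> U i" using v i by (auto simp: PiE_iff)
        ultimately show ?thesis using eq by simp
      next
        case False
        then show ?thesis using y i by (auto simp: PiE_iff)
      qed
      then show "y \<in> ?W" using y by (auto simp: PiE_iff)
    qed
    ultimately have "controls ?F ?W" using U(1) unfolding controls_def by blast
    with \<open>openin ?S ?W\<close> have "?W \<in> \<U>" unfolding \<U>_def by blast
    moreover have "x \<in> ?W" using U(3) x by simp
    ultimately show "x \<in> \<Union>\<U>" by (rule UnionI)
  qed
  moreover have "\<forall>W\<in>\<U>. openin ?S W" by (simp add: \<U>_def)
  ultimately obtain \<F> where \<F>: "finite \<F>" "\<F> \<subseteq> \<U>" "topspace ?S \<subseteq> \<Union>\<F>"
    using C unfolding compact_space_alt by meson
  have "\<forall>W\<in>\<F>. \<exists>F. controls F W" using \<F>(2) unfolding \<U>_def by blast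
  from bchoice[OF this] obtain F where F: "\<And>W. W \<in> \<F> \<Longrightarrow> controls (F W) W" by blast
  show thesis
  proof
    show "finite (\<Union>(F ` \<F>))" "\<Union>(F ` \<F>) \<subseteq> I" using F \<F>(1) unfolding controls_def by blast+
    show "\<forall>x\<in>topspace ?S. \<forall>y\<in>topspace ?S. (\<forall>i\<in>\<Union>(F ` \<F>). x i = y i) \<longrightarrow> dist (z x) (z y) < e"
    proof (intro ballI impI)
      fix x y assume x: "x \<in> topspace ?S" and y: "y \<in> topspace ?S"
        and eq: "\<forall>i\<in>\<Union>(F ` \<F>). x i = y i"
      obtain W where W: "W \<in> \<F>" "x \<in> W" using \<F>(3) x by blast
      have "\<forall>i\<in>F W. x i = y i" using eq W(1) by blast
      then have "y \<in> W" using F[OF W(1)] W(2) y unfolding controls_def by blast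
      moreover obtain c where "\<forall>x\<in>W. dist (z x) c < e / 2" using F[OF W(1)] unfolding controls_def by blast
      ultimately have "dist (z x) c < e / 2" "dist (z y) c < e / 2" using W(2) by blast+
      then show "dist (z x) (z y) < e" by (metis dist_commute dist_triangle_half_l)
    qed
  qed
qed

lemma Well_order_finite_upper_bound:
  assumes r: "Well_order r" and F: "finite F" "F \<subseteq> Field r" and ne: "Field r \<noteq> {}"
  obtains m where "m \<in> Field r" "\<And>a. a \<in> F \<Longrightarrow> (a, m) \<in> r"
proof -
  interpret wo_rel r using r by (simp add: wo_rel_def)
  have "\<exists>m\<in>Field r. \<forall>a\<in>F. (a, m) \<in> r" using F
  proof (induction F)
    case empty
    then show ?case using ne by blast
  next
    case (insert b F)
    then obtain m where m: "m \<in> Field r" "\<forall>a\<in>F. (a, m) \<in> r" by blast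
    have b: "b \<in> Field r" using insert.prems by blast
    show ?case
    proof (cases "(b, m) \<in> r")
      case True
      then show ?thesis using m by blast
    next
      case False
      then have "(m, b) \<in> r" using TOTALS m(1) b by blast
      then have "\<forall>a\<in>insert b F. (a, b) \<in> r" 
        using m(2) b TRANS REFL by (auto simp: trans_def refl_on_def)
      then show ?thesis using b by blast
    qed
  qed
  then show thesis using that by blast
qed

text \<open>A finite set of coordinates in the limit is determined by its largest member \<open>\<alpha>\<close>. Hence \<open>z\<close> nearly
  factors through the projection to \<open>Y \<alpha>\<close>, and the coherent sections \<open>t\<close> assemble to a section
  of that projection. Approximate
  factorisation holds for every cofinality of the length; for countable cofinality \<open>z\<close> may
  fail to factor exactly.\<close>

lemma twisted_inverse_limit_factor:
  assumes cont: "continuous_inverse_sequence r Y p" and ri: "right_invertible_bonding r Y p"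
    and X: "X homeomorphic_space inverse_limit r (Field r) Y p" and tw: "twisted X z"
  obtains \<alpha> z' where "\<alpha> \<in> Field r" "twisted (Y \<alpha>) z'"
proof -
  let ?L = "inverse_limit r (Field r) Y p"
  have W: "Well_order r" 
    using cont by (simp add: continuous_inverse_sequence_def inverse_sequence_def)
  obtain h k where hk: "homeomorphic_maps X ?L h k" using X unfolding homeomorphic_space_def by blast
  have c: "compact_space X" using tw by (simp add: twisted_def)
  then have cL: "compact_space ?L" using X homeomorphic_compact_space by blast
  have twL: "twisted ?L (\<lambda>y. z (k y))"
    by (rule twisted_approximate_factor[OF tw cL, of h k]) (use hk in \<open>auto simp: homeomorphic_maps_def\<close>)
  have zc: "continuous_map ?L euclidean (\<lambda>y. z (k y))" using twL by (simp add: twisted_def)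
  have ne: "Field r \<noteq> {}"
  proof
    assume "Field r = {}"
    then have "topspace ?L \<subseteq> {\<lambda>_. undefined}"
      by (auto simp: topspace_inverse_limit extensional_def)
    then have "finite (Pow (topspace ?L))" by (simp add: finite_subset)
    moreover have "{U. openin ?L U} \<subseteq> Pow (topspace ?L)" using openin_subset by blast
    ultimately have "countable {U. openin ?L U}" by (meson countable_finite finite_subset)
    then have "second_countable ?L"
      unfolding second_countable_def by (intro exI[of _ "{U. openin ?L U}"]) auto
    then show False using twL second_countable_not_twisted by blast
  qed
  obtain F where F: "finite F" "F \<subseteq> Field r"
    "\<forall>x\<in>topspace ?L. \<forall>y\<in>topspace ?L. (\<forall>i\<in>F. x i = y i) \<longrightarrow> dist (z (k x)) (z (k y)) < 1"
    using that by (rule compact_subproduct_finite_dependence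
      [OF cL[unfolded inverse_limit_def] zc[unfolded inverse_limit_def] zero_less_one,
        folded inverse_limit_def])
  obtain \<alpha> where \<alpha>: "\<alpha> \<in> Field r" "\<And>a. a \<in> F \<Longrightarrow> (a, \<alpha>) \<in> r"
    using Well_order_finite_upper_bound[OF W F(1,2) ne] by blast
  obtain t where t: "\<And>\<beta>. \<beta> \<in> Field r \<Longrightarrow> continuous_map (Y \<alpha>) (Y \<beta>) (t \<beta>)"
    "\<And>\<beta> \<gamma> y. \<lbrakk>(\<beta>, \<gamma>) \<in> r; y \<in> topspace (Y \<alpha>)\<rbrakk> \<Longrightarrow> p \<beta> \<gamma> (t \<gamma> y) = t \<beta> y"
    "\<And>y. y \<in> topspace (Y \<alpha>) \<Longrightarrow> t \<alpha> y = y"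
    using inverse_sequence_sections[OF cont ri \<alpha>(1)] by blast
  define s where "s y = (\<lambda>\<beta>\<in>Field r. t \<beta> y)" for y
  have cs: "continuous_map (Y \<alpha>) ?L s"
  proof (rule continuous_map_into_inverse_limit)
    show "continuous_map (Y \<alpha>) (Y \<beta>) (\<lambda>y. s y \<beta>)" if "\<beta> \<in> Field r" for \<beta>
      using t(1)[OF that] that by (simp add: s_def)
  qed (use t(2) in \<open>auto simp: s_def\<close>)
  have cp: "continuous_map ?L (Y \<alpha>) (\<lambda>x. x \<alpha>)"
    using continuous_map_inverse_limit_projection[OF \<alpha>(1)] .
  have pL: "x \<alpha> \<in> topspace (Y \<alpha>)" if "x \<in> topspace ?L" for x
    using that \<alpha>(1) by (simp add: topspace_inverse_limit)
  have sL: "s y \<in> topspace ?L" if "y \<in> topspace (Y \<alpha>)" for y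
    using cs that by (auto simp: continuous_map_def)
  have "compact_space (Y \<alpha>)"
  proof -
    have "y \<in> (\<lambda>x. x \<alpha>) ` topspace ?L" if "y \<in> topspace (Y \<alpha>)" for y
    proof (rule image_eqI)
      show "y = s y \<alpha>" using t(3)[OF that] \<alpha>(1) by (simp add: s_def)
    qed (rule sL[OF that])
    then have "(\<lambda>x. x \<alpha>) ` topspace ?L = topspace (Y \<alpha>)" using pL by blast
    then show ?thesis
      using image_compactin[OF _ cp, of "topspace ?L"] cL by (simp add: compact_space_def)
  qed
  moreover have "dist (z (k (s (x \<alpha>)))) (z (k x)) < 1" if x: "x \<in> topspace ?L" for x
  proof -
    have "s (x \<alpha>) a = x a" if a: "a \<in> F" for a
    proof -
      have "s (x \<alpha>) a = t a (x \<alpha>)" using a F(2) by (auto simp: s_def)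
      also have "\<dots> = p a \<alpha> (t \<alpha> (x \<alpha>))" using t(2)[OF \<alpha>(2)[OF a] pL[OF x]] by simp
      also have "\<dots> = p a \<alpha> (x \<alpha>)" using t(3)[OF pL[OF x]] by simp
      also have "\<dots> = x a" using x a \<alpha> F(2) by (auto simp: topspace_inverse_limit)
      finally show ?thesis .
    qed
    then show ?thesis using F(3) sL[OF pL[OF x]] x by blast
  qed
  ultimately have "twisted (Y \<alpha>) (\<lambda>y. z (k (s y)))"
    using twisted_approximate_factor[OF twL _ cp cs] by blast
  then show thesis using that \<alpha>(1) by blast
qed

theorem class_R_not_twisted:
  assumes "class_R X"
  shows "\<not> twisted X z"
  using assms
proof (induction arbitrary: z rule: class_R.induct)
  case (compact_metrizable X)
  then show ?case
    using compact_metrizable_imp_second_countable second_countable_not_twisted by blast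
next
  case (limit_of_sequence r Y p X)
  show ?case
  proof
    assume "twisted X z"
    with twisted_inverse_limit_factor[OF limit_of_sequence(1,2,3)]
    obtain \<alpha> z' where "\<alpha> \<in> Field r" "twisted (Y \<alpha>) z'" by blast
    then show False using limit_of_sequence(4) by blast
  qed
qed

section \<open>Valdivia compact spaces\<close>

text \<open>A Loewenheim-Skolem argument: iterate the operation countably often; a list has only finitely
  many entries, which all appear at some finite stage.\<close>

lemma countable_closure_under_list_operation:
  fixes c :: "'a list \<Rightarrow> 'a set"
  assumes S0: "countable S0" "S0 \<subseteq> A" and c: "\<And>xs. set xs \<subseteq> A \<Longrightarrow> countable (c xs) \<and> c xs \<subseteq> A"
  obtains S where "countable S" "S0 \<subseteq> S" "S \<subseteq> A" "\<And>xs. set xs \<subseteq> S \<Longrightarrow> c xs \<subseteq> S"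
proof -
  define g where "g n = ((\<lambda>S. S \<union> (\<Union>xs\<in>lists S. c xs)) ^^ n) S0" for n
  have g0: "g 0 = S0" and gS: "g (Suc n) = g n \<union> (\<Union>xs\<in>lists (g n). c xs)" for n
    by (simp_all add: g_def)
  have g: "countable (g n) \<and> g n \<subseteq> A" for n
  proof (induction n)
    case 0
    then show ?case using S0 by (simp add: g0)
  next
    case (Suc n)
    then have "countable (c xs) \<and> c xs \<subseteq> A" if "xs \<in> lists (g n)" for xs
      using c[of xs] that by (auto simp: lists_eq_set)
    then show ?case unfolding gS using Suc by (intro conjI countable_Un countable_UN countable_lists) auto
  qed
  have mono: "g m \<subseteq> g n" if "m \<le> n" for m n
    using that by (induction n rule: dec_induct) (auto simp: gS)
  have closed: "c xs \<subseteq> (\<Union>n. g n)" if "set xs \<subseteq> (\<Union>n. g n)" for xs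
  proof -
    have "\<exists>n. set xs \<subseteq> g n" using that
    proof (induction xs)
      case (Cons x xs)
      then obtain m n where "set xs \<subseteq> g m" "x \<in> g n" by auto
      then have "set (x # xs) \<subseteq> g (max m n)" using mono[of m "max m n"] mono[of n "max m n"] by auto
      then show ?case ..
    qed simp
    then obtain n where "set xs \<subseteq> g n" ..
    then have "c xs \<subseteq> g (Suc n)" unfolding gS by (auto simp: lists_eq_set)
    then show ?thesis by blast
  qed
  show thesis
  proof (rule that[of "\<Union>n. g n"])
    show "S0 \<subseteq> (\<Union>n. g n)" using g0 by blast
  qed (use g closed in auto)
qed

definition zero_outside :: "'k set \<Rightarrow> 'k set \<Rightarrow> ('k \<Rightarrow> real) \<Rightarrow> 'k \<Rightarrow> real" where
  "zero_outside A S y = (\<lambda>a\<in>A. if a \<in> S then y a else 0)"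

text \<open>For every basic open condition with rational bounds on finitely many coordinates that is met by
  a point of the dense set, choose one such point \<open>d\<close>. Take \<open>S\<close> closed in the sense that the
  countable support of \<open>d\<close> lies in \<open>S\<close> whenever the coordinates of the condition do. A basic
  neighbourhood of \<open>zero_outside A S x\<close> restricts the coordinates in \<open>S\<close> to be near those of
  \<open>x\<close> and the others to be near 0; the chosen point for the former condition satisfies the
  latter automatically. So the retracted point lies in the closed set \<open>C\<close>.\<close>

lemma valdivia_countable_coordinate_retraction:
  fixes A :: "'k set"
  assumes C: "closedin (unit_cube A) C"
    and dense: "C \<subseteq> unit_cube A closure_of (C \<inter> sigma_product A)"
    and S0: "countable S0" "S0 \<subseteq> A"
  obtains S where "countable S" "S0 \<subseteq> S" "S \<subseteq> A" "\<And>x. x \<in> C \<Longrightarrow> zero_outside A S x \<in> C"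
proof -
  let ?Q = "unit_cube A" and ?D = "C \<inter> sigma_product A"
  define box :: "'k list \<Rightarrow> (rat \<times> rat) list \<Rightarrow> ('k \<Rightarrow> real) \<Rightarrow> bool" where
    "box as qs y \<longleftrightarrow> (\<forall>(a, p, q) \<in> set (zip as qs). of_rat p < y a \<and> y a < of_rat q)" for as qs y
  define d where "d as qs = (SOME y. y \<in> ?D \<and> box as qs y)" for as qs
  define c where "c as = (\<Union>qs\<in>{qs. \<exists>y\<in>?D. box as qs y}. {a \<in> A. d as qs a \<noteq> 0})" for as
  have d: "d as qs \<in> ?D \<and> box as qs (d as qs)" if "\<exists>y\<in>?D. box as qs y" for as qs
    unfolding d_def using someI_ex[of "\<lambda>y. y \<in> ?D \<and> box as qs y"] that by blast
  have "countable (c as) \<and> c as \<subseteq> A" for as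
    unfolding c_def using d by (auto intro!: countable_UN simp: sigma_product_def)
  then obtain S where S: "countable S" "S0 \<subseteq> S" "S \<subseteq> A" "\<And>as. set as \<subseteq> S \<Longrightarrow> c as \<subseteq> S"
    using countable_closure_under_list_operation[OF S0, of c] by metis
  have "zero_outside A S x \<in> C" if x: "x \<in> C" for x
  proof (rule ccontr)
    let ?r = "zero_outside A S x"
    assume "?r \<notin> C"
    have x01: "x \<in> (\<Pi>\<^sub>E a\<in>A. {0..1})"
      using closedin_subset[OF C] x by auto
    then have "?r \<in> topspace ?Q" by (auto simp: zero_outside_def)
    then have rC: "?r \<in> topspace ?Q - C" using \<open>?r \<notin> C\<close> by blast
    have "openin ?Q (topspace ?Q - C)" using C unfolding closedin_def by blast
    from bspec[OF iffD1[OF openin_product_topology_alt this] rC] obtain U where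
      U: "finite {a \<in> A. U a \<noteq> topspace (top_of_set {0..1})}"
        "\<forall>a\<in>A. openin (top_of_set {0..1}) (U a)"
        "?r \<in> Pi\<^sub>E A U" "Pi\<^sub>E A U \<subseteq> topspace ?Q - C"
      by (elim exE conjE)
    define F where "F = {a \<in> A. U a \<noteq> {0..1}} \<inter> S"
    have "finite F" using U(1) by (simp add: F_def)
    then obtain as where as: "set as = F" using finite_list by blast
    have "\<exists>p q. of_rat p < x a \<and> x a < of_rat q \<and> {of_rat p<..<of_rat q} \<inter> {0..1} \<subseteq> U a"
      if a: "a \<in> F" for a
    proof -
      have aA: "a \<in> A" "a \<in> S" using a by (auto simp: F_def)
      obtain T where T: "open T" "U a = {0..1} \<inter> T" using bspec[OF U(2) aA(1)] by (auto simp: openin_open)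
      have "?r a \<in> U a" using U(3) aA by auto
      then have "x a \<in> T" using T aA by (simp add: zero_outside_def)
      then obtain e where e: "e > 0" "ball (x a) e \<subseteq> T" using T(1) open_contains_ball by blast
      obtain p where p: "x a - e < of_rat p" "of_rat p < x a" using of_rat_dense[of "x a - e" "x a"] e by auto
      obtain q where q: "x a < of_rat q" "of_rat q < x a + e" using of_rat_dense[of "x a" "x a + e"] e by auto
      have "{of_rat p<..<of_rat q} \<subseteq> ball (x a) e" using p q by (auto simp: dist_real_def)
      then show ?thesis using p q e T by blast
    qed
    then obtain P R where PR: "\<And>a. a \<in> F \<Longrightarrow> of_rat (P a) < x a \<and> x a < of_rat (R a) \<and>
        {of_rat (P a)<..<of_rat (R a)} \<inter> {0..1} \<subseteq> U a" by metis
    define qs where "qs = map (\<lambda>a. (P a, R a)) as"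
    have box: "box as qs y \<longleftrightarrow> (\<forall>a\<in>F. of_rat (P a) < y a \<and> y a < of_rat (R a))" for y
      unfolding box_def qs_def as[symmetric] by (auto simp: zip_map2 zip_same_conv_map)
    let ?I = "\<lambda>a. if a \<in> F then {of_rat (P a)<..<of_rat (R a)} \<inter> {0..1} else {0..1::real}"
    have ex: "\<exists>y\<in>?D. box as qs y"
    proof -
      have "x \<in> ?Q closure_of ?D" using dense x by blast
      moreover have "openin ?Q (\<Pi>\<^sub>E a\<in>A. ?I a)"
      proof -
        have "openin (top_of_set {0..1}) (?I a)" for a
          by (auto simp: openin_open)
        moreover have "finite {a \<in> A. ?I a \<noteq> topspace (top_of_set {0..1})}"
          by (rule finite_subset[OF _ \<open>finite F\<close>]) auto
        ultimately show ?thesis by (simp add: openin_PiE_gen)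
      qed
      moreover have "x \<in> (\<Pi>\<^sub>E a\<in>A. ?I a)"
        using x01 PR by (auto simp: PiE_iff)
      ultimately obtain y where y: "y \<in> ?D"
        "y \<in> (\<Pi>\<^sub>E a\<in>A. ?I a)"
        unfolding in_closure_of by blast
      have "of_rat (P a) < y a \<and> y a < of_rat (R a)" if a: "a \<in> F" for a
      proof -
        have "a \<in> A" using a by (simp add: F_def)
        then have "y a \<in> ?I a"
          using y(2) by (rule PiE_mem[rotated])
        then show ?thesis using a by simp
      qed
      then show ?thesis using y(1) box by blast
    qed
    have dD: "d as qs \<in> ?D" "box as qs (d as qs)" using d[OF ex] by blast+
    have dS: "{a \<in> A. d as qs a \<noteq> 0} \<subseteq> S"
    proof -
      have "{a \<in> A. d as qs a \<noteq> 0} \<subseteq> c as" unfolding c_def using ex by blast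
      also have "c as \<subseteq> S" by (rule S(4)) (simp add: as F_def)
      finally show ?thesis .
    qed
    have d01: "d as qs \<in> (\<Pi>\<^sub>E a\<in>A. {0..1})" using dD(1) by (simp add: sigma_product_def)
    have "d as qs a \<in> U a" if a: "a \<in> A" for a
    proof (cases "U a = {0..1}")
      case True
      then show ?thesis using d01 a by auto
    next
      case False
      show ?thesis
      proof (cases "a \<in> S")
        case True
        then have "a \<in> F" using False a by (simp add: F_def)
        then show ?thesis using dD(2) box PR[of a] d01 a by fastforce
      next
        case nS: False
        then have "d as qs a = 0" using dS a by blast
        moreover have "?r a = 0" using nS a by (simp add: zero_outside_def)
        moreover have "?r a \<in> U a" using U(3) a by auto
        ultimately show ?thesis by simp
      qed
    qed
    then have "d as qs \<in> Pi\<^sub>E A U" using d01 by (auto simp: PiE_iff)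
    then show False using U(4) dD(1) by blast
  qed
  then show thesis using that S by blast
qed

lemma second_countable_countable_cube:
  assumes "countable S"
  shows "second_countable (unit_cube S)"
proof (rule compact_metrizable_imp_second_countable)
  show "compact_space (unit_cube S)" 
    by (simp add: compact_space_product_topology compact_space_subtopology)
  have "countable {i \<in> S. \<not> (\<exists>a. topspace (top_of_set {0..1::real}) \<subseteq> {a})}"
    by (rule countable_subset[OF _ assms]) auto
  then show "metrizable_space (unit_cube S)"
    unfolding metrizable_space_product_topology
    by (simp add: metrizable_space_subtopology metrizable_space_euclidean)
qed

text \<open>Starting the countable set of coordinates from a finite one that controls \<open>z\<close> makes the
  retraction onto countably many coordinates preserve \<open>z\<close> up to a small error, and its image is
  second countable.\<close>

theorem valdivia_compact_not_twisted:
  assumes "valdivia_compact K"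
  shows "\<not> twisted K z"
proof
  assume tw: "twisted K z"
  obtain A :: "('a \<Rightarrow> real) set" and f where K: "compact_space K" and f: "valdivia_embedding K A f"
    using assms unfolding valdivia_compact_def by blast
  let ?Q = "unit_cube A" and ?C = "f ` topspace K"
  let ?X = "subtopology ?Q ?C"
  obtain k where k: "homeomorphic_maps K ?X f k"
    using f unfolding valdivia_embedding_def embedding_map_def homeomorphic_map_maps by blast
  have CQ: "?C \<subseteq> topspace ?Q"
  proof -
    have "continuous_map K ?X f" using k by (simp add: homeomorphic_maps_def)
    then have "f ` topspace K \<subseteq> topspace ?X" by (rule continuous_map_image_subset_topspace)
    then show ?thesis by simp
  qed
  have topX: "topspace ?X = ?C" using CQ by auto
  have X: "compact_space ?X" using k K homeomorphic_space_def homeomorphic_compact_space by blast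
  have "closedin ?Q ?C"
  proof (rule compactin_imp_closedin)
    show "compactin ?Q ?C" using X CQ by (simp add: compactin_subspace)
    show "Hausdorff_space ?Q" by (simp add: Hausdorff_space_product_topology Hausdorff_space_subtopology)
  qed
  have twX: "twisted ?X (\<lambda>y. z (k y))"
    by (rule twisted_approximate_factor[OF tw X, of f k]) (use k in \<open>auto simp: homeomorphic_maps_def\<close>)
  then have zc: "continuous_map ?X euclidean (\<lambda>y. z (k y))" by (simp add: twisted_def)
  obtain F where F: "finite F" "F \<subseteq> A"
    "\<forall>x\<in>topspace ?X. \<forall>y\<in>topspace ?X. (\<forall>i\<in>F. x i = y i) \<longrightarrow> dist (z (k x)) (z (k y)) < 1"
    using that by (rule compact_subproduct_finite_dependence[OF X zc zero_less_one])
  have dense: "?C \<subseteq> ?Q closure_of (?C \<inter> sigma_product A)"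
  proof -
    have "?C = ?X closure_of (?C \<inter> sigma_product A)" using f by (simp add: valdivia_embedding_def)
    also have "\<dots> \<subseteq> ?Q closure_of (?C \<inter> sigma_product A)" by (rule closure_of_subtopology_subset)
    finally show ?thesis .
  qed
  obtain S where S: "countable S" "F \<subseteq> S" "S \<subseteq> A" "\<And>x. x \<in> ?C \<Longrightarrow> zero_outside A S x \<in> ?C"
    using valdivia_countable_coordinate_retraction
      [OF \<open>closedin ?Q ?C\<close> dense countable_finite[OF F(1)] F(2)] by metis
  define p :: "(('a \<Rightarrow> real) \<Rightarrow> real) \<Rightarrow> ('a \<Rightarrow> real) \<Rightarrow> real" where "p x = restrict x S" for x
  let ?Y = "subtopology (unit_cube S) (p ` ?C)"
  have cp: "continuous_map ?X ?Y p"
  proof -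
    have "continuous_map ?Q (unit_cube S) p"
      unfolding p_def continuous_map_componentwise
      using S(3) by (auto intro!: continuous_map_product_projection)
    then show ?thesis
      using CQ by (auto simp: continuous_map_in_subtopology intro: continuous_map_from_subtopology)
  qed
  have rp: "zero_outside A S (p x) = zero_outside A S x" for x
    by (auto simp: zero_outside_def p_def fun_eq_iff)
  have cs: "continuous_map ?Y ?X (zero_outside A S)"
  proof -
    have "continuous_map (unit_cube S) ?Q (zero_outside A S)"
      unfolding zero_outside_def continuous_map_componentwise
      by (auto intro!: continuous_map_product_projection)
    then show ?thesis
      using S(4) rp by (auto simp: continuous_map_in_subtopology intro: continuous_map_from_subtopology)
  qed
  have "p ` ?C = topspace ?Y" using cp topX unfolding continuous_map_def by auto
  then have "compact_space ?Y"
    using image_compactin[OF _ cp, of "topspace ?X"] X topX unfolding compact_space_def by metis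
  moreover have "dist (z (k (zero_outside A S (p x)))) (z (k x)) < 1" if x: "x \<in> topspace ?X" for x
  proof -
    have "\<forall>i\<in>F. zero_outside A S x i = x i" using S(2) F(2) by (auto simp: zero_outside_def)
    moreover have "zero_outside A S x \<in> topspace ?X" using S(4) x topX by blast
    ultimately show ?thesis unfolding rp using F(3) x by blast
  qed
  ultimately have "twisted ?Y (\<lambda>y. z (k (zero_outside A S y)))"
    using twisted_approximate_factor[OF twX _ cp cs] by blast
  moreover have "second_countable ?Y"
    using second_countable_countable_cube[OF S(1)] by (rule second_countable_subtopology)
  ultimately show False using second_countable_not_twisted by blast
qed

section \<open>The group\<close>

text \<open>The coordinates of the group have to be sets of natural numbers. The even elements of
  \<open>encode j n\<close> record \<open>n\<close>, the odd ones record \<open>j\<close>; the set \<open>{}\<close> is left over for the coordinate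
  \<open>z\<close>.\<close>

definition encode :: "nat set \<Rightarrow> nat \<Rightarrow> nat set" where
  "encode j n = insert (2 * n) ((\<lambda>k. 2 * k + 1) ` j)"

definition code_digits :: "nat set \<Rightarrow> nat set" where "code_digits i = {k. 2 * k + 1 \<in> i}"

text \<open>At \<open>{}\<close>, the index of the coordinate \<open>z\<close>, the value is an unspecified number.\<close>

definition code_level :: "nat set \<Rightarrow> nat" where "code_level i = (LEAST n. 2 * n \<in> i)"

lemma encode_nonempty [simp]: "encode j n \<noteq> {}"
  by (simp add: encode_def)

lemma code_digits_encode [simp]: "code_digits (encode j n) = j"
proof (rule Set.set_eqI)
  fix k :: nat
  have "2 * k + 1 \<noteq> 2 * n" by presburger
  then show "k \<in> code_digits (encode j n) \<longleftrightarrow> k \<in> j"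
    unfolding code_digits_def encode_def by (simp add: image_iff)
qed

lemma code_level_encode [simp]: "code_level (encode j n) = n"
proof -
  have "2 * m \<in> encode j n \<longleftrightarrow> m = n" for m
    unfolding encode_def by (auto simp: image_iff; presburger)
  then show ?thesis unfolding code_level_def by (simp add: Least_equality)
qed

definition coordinates :: "nat set set \<Rightarrow> nat set set" where
  "coordinates J = insert {} ((\<lambda>(j, n). encode j n) ` (J \<times> UNIV))"

lemma coordinates_cases:
  assumes "i \<in> coordinates J"
  obtains "i = {}" | j n where "j \<in> J" "i = encode j n"
  using assms by (auto simp: coordinates_def)

lemma in_coordinates [simp]: "{} \<in> coordinates J" "j \<in> J \<Longrightarrow> encode j n \<in> coordinates J"
  by (auto simp: coordinates_def)

text \<open>Indices outside \<open>coordinates J\<close> carry the dummy value 1, so that the operations and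
  the topology can be taken from the full function space.\<close>

definition dyadic_tower :: "nat set set \<Rightarrow> (nat set \<Rightarrow> complex) set" where
  "dyadic_tower J = {x. (\<forall>i. norm (x i) = 1) \<and> (\<forall>i. i \<notin> coordinates J \<longrightarrow> x i = 1) \<and>
     (\<forall>j\<in>J. \<forall>n. x (encode j n) = (if n \<in> j then x {} else 1) * (x (encode j (Suc n)))\<^sup>2)}"

lemma dyadic_towerD:
  assumes "x \<in> dyadic_tower J"
  shows "norm (x i) = 1" "x i \<noteq> 0" "i \<notin> coordinates J \<Longrightarrow> x i = 1"
    "j \<in> J \<Longrightarrow> x (encode j n) = (if n \<in> j then x {} else 1) * (x (encode j (Suc n)))\<^sup>2"
proof -
  show "norm (x i) = 1" using assms by (simp add: dyadic_tower_def)
  then show "x i \<noteq> 0" by auto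
qed (use assms in \<open>unfold dyadic_tower_def, blast+\<close>)

lemma dyadic_towerI:
  assumes "\<And>i. norm (x i) = 1" "\<And>i. i \<notin> coordinates J \<Longrightarrow> x i = 1"
    "\<And>j n. j \<in> J \<Longrightarrow> x (encode j n) = (if n \<in> j then x {} else 1) * (x (encode j (Suc n)))\<^sup>2"
  shows "x \<in> dyadic_tower J"
  using assms unfolding dyadic_tower_def by blast

lemma dyadic_tower_mult:
  assumes "x \<in> dyadic_tower J" "y \<in> dyadic_tower J"
  shows "(\<lambda>i. x i * y i) \<in> dyadic_tower J"
proof (rule dyadic_towerI)
  fix j n assume j: "j \<in> J"
  show "x (encode j n) * y (encode j n) =
      (if n \<in> j then x {} * y {} else 1) * (x (encode j (Suc n)) * y (encode j (Suc n)))\<^sup>2"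
    by (subst dyadic_towerD(4)[OF assms(1) j], subst dyadic_towerD(4)[OF assms(2) j])
      (simp add: power_mult_distrib)
qed (simp_all add: norm_mult dyadic_towerD(1,3)[OF assms(1)] dyadic_towerD(1,3)[OF assms(2)])

lemma dyadic_tower_inverse:
  assumes "x \<in> dyadic_tower J"
  shows "(\<lambda>i. inverse (x i)) \<in> dyadic_tower J"
proof (rule dyadic_towerI)
  fix j n assume j: "j \<in> J"
  show "inverse (x (encode j n)) =
      (if n \<in> j then inverse (x {}) else 1) * (inverse (x (encode j (Suc n))))\<^sup>2"
    by (subst dyadic_towerD(4)[OF assms j]) (simp add: power_inverse)
qed (simp_all add: norm_inverse dyadic_towerD(1,3)[OF assms])

definition dyadic_group :: "nat set set \<Rightarrow> (nat set \<Rightarrow> complex) monoid" where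
  "dyadic_group J = \<lparr>carrier = dyadic_tower J, mult = \<lambda>x y i. x i * y i, one = \<lambda>_. 1\<rparr>"

abbreviation dyadic_topology :: "nat set set \<Rightarrow> (nat set \<Rightarrow> complex) topology" where
  "dyadic_topology J \<equiv> top_of_set (dyadic_tower J)"

lemma comm_group_dyadic_group: "comm_group (dyadic_group J)"
proof (rule comm_groupI)
  fix x y assume "x \<in> carrier (dyadic_group J)" "y \<in> carrier (dyadic_group J)"
  then show "x \<otimes>\<^bsub>dyadic_group J\<^esub> y \<in> carrier (dyadic_group J)"
    by (simp add: dyadic_group_def dyadic_tower_mult)
next
  fix x assume x: "x \<in> carrier (dyadic_group J)"
  then have x': "x \<in> dyadic_tower J" by (simp add: dyadic_group_def)
  show "\<exists>y\<in>carrier (dyadic_group J). y \<otimes>\<^bsub>dyadic_group J\<^esub> x = \<one>\<^bsub>dyadic_group J\<^esub>"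
    using dyadic_tower_inverse[OF x'] dyadic_towerD(2)[OF x']
    by (intro bexI[of _ "\<lambda>i. inverse (x i)"]) (simp_all add: dyadic_group_def)
next
  show "\<one>\<^bsub>dyadic_group J\<^esub> \<in> carrier (dyadic_group J)"
    by (simp add: dyadic_group_def) (rule dyadic_towerI; simp)
qed (simp_all add: dyadic_group_def ac_simps)

lemma inv_dyadic_group:
  assumes "x \<in> dyadic_tower J"
  shows "inv\<^bsub>dyadic_group J\<^esub> x = (\<lambda>i. inverse (x i))"
proof -
  interpret comm_group "dyadic_group J" by (rule comm_group_dyadic_group)
  show ?thesis
  proof (rule inv_equality)
    show "(\<lambda>i. inverse (x i)) \<otimes>\<^bsub>dyadic_group J\<^esub> x = \<one>\<^bsub>dyadic_group J\<^esub>"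
      using dyadic_towerD(2)[OF assms] by (simp add: dyadic_group_def)
  qed (use assms dyadic_tower_inverse in \<open>simp_all add: dyadic_group_def\<close>)
qed

lemma continuous_map_into_functions:
  fixes f :: "'a \<Rightarrow> 'i \<Rightarrow> 'b::topological_space"
  shows "continuous_map X euclidean f \<longleftrightarrow> (\<forall>i. continuous_map X euclidean (\<lambda>x. f x i))"
  by (simp add: continuous_map_componentwise_UNIV flip: euclidean_product_topology)

lemma continuous_map_coordinate:
  "continuous_map (dyadic_topology J) euclidean (\<lambda>x. x i)"
  using continuous_on_product_then_coordinatewise[OF continuous_on_id] by (simp add: id_def)

lemma topological_group_dyadic_group:
  "topological_group (dyadic_group J) (dyadic_topology J)"
proof -
  let ?T = "dyadic_topology J"
  interpret comm_group "dyadic_group J" by (rule comm_group_dyadic_group)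
  have car: "carrier (dyadic_group J) = dyadic_tower J" by (simp add: dyadic_group_def)
  have "continuous_map (prod_topology ?T ?T) euclidean (\<lambda>(x, y). x \<otimes>\<^bsub>dyadic_group J\<^esub> y)"
    unfolding continuous_map_into_functions
  proof
    fix i
    have "continuous_map (prod_topology ?T ?T) euclidean (\<lambda>p. fst p i * snd p i)"
    proof (rule continuous_map_complex_mult)
      show "continuous_map (prod_topology ?T ?T) euclidean (\<lambda>p. fst p i)"
        using continuous_map_compose[OF continuous_map_fst continuous_map_coordinate[of J i]]
        unfolding o_def .
      show "continuous_map (prod_topology ?T ?T) euclidean (\<lambda>p. snd p i)"
        using continuous_map_compose[OF continuous_map_snd continuous_map_coordinate[of J i]]
        unfolding o_def .
    qed
    then show "continuous_map (prod_topology ?T ?T) euclidean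
        (\<lambda>p. (case p of (x, y) \<Rightarrow> x \<otimes>\<^bsub>dyadic_group J\<^esub> y) i)"
      by (simp add: dyadic_group_def case_prod_unfold)
  qed
  then have "continuous_map (prod_topology ?T ?T) ?T (\<lambda>(x, y). x \<otimes>\<^bsub>dyadic_group J\<^esub> y)"
    using m_closed by (auto simp: continuous_map_in_subtopology car)
  moreover have "continuous_map ?T ?T (\<lambda>x. inv\<^bsub>dyadic_group J\<^esub> x)"
  proof -
    have "continuous_map ?T euclidean (\<lambda>x i. inverse (x i))"
      unfolding continuous_map_into_functions
    proof
      fix i
      show "continuous_map ?T euclidean (\<lambda>x. inverse (x i))"
        using continuous_map_complex_divide[OF _ continuous_map_coordinate[of J i], of "\<lambda>_. 1"]
          dyadic_towerD(2) by (auto simp: inverse_eq_divide)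
    qed
    then have "continuous_map ?T euclidean (\<lambda>x. inv\<^bsub>dyadic_group J\<^esub> x)"
      by (rule continuous_map_eq) (simp add: inv_dyadic_group)
    then show ?thesis using inv_closed by (auto simp: continuous_map_in_subtopology car)
  qed
  ultimately show ?thesis unfolding topological_group_def using is_group by (simp add: car)
qed

lemma compact_dyadic_tower: "compact (dyadic_tower J)"
proof -
  let ?E = "{x :: nat set \<Rightarrow> complex. (\<forall>i. i \<notin> coordinates J \<longrightarrow> x i = 1) \<and>
    (\<forall>j\<in>J. \<forall>n. x (encode j n) = (if n \<in> j then x {} else 1) * (x (encode j (Suc n)))\<^sup>2)}"
  have "compactin (product_topology (\<lambda>_. euclidean) UNIV) (Pi\<^sub>E UNIV (\<lambda>_::nat set. sphere (0::complex) 1))"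
    by (simp add: compactin_PiE)
  then have "compact (Pi\<^sub>E UNIV (\<lambda>_::nat set. sphere (0::complex) 1))"
    by (simp add: euclidean_product_topology)
  moreover have "closed ?E"
  proof -
    have c: "continuous_on UNIV (\<lambda>x :: nat set \<Rightarrow> complex. (if P then x i else 1) * (x k)\<^sup>2)" for P i k
      by (cases P) (auto intro!: continuous_intros)
    show ?thesis
      unfolding Ball_def
      by (intro closed_Collect_conj closed_Collect_all closed_Collect_imp closed_Collect_eq c
          continuous_on_const continuous_on_product_coordinates open_Collect_const)
  qed
  ultimately have "compact (Pi\<^sub>E UNIV (\<lambda>_. sphere 0 1) \<inter> ?E)" by (rule compact_Int_closed)
  moreover have "Pi\<^sub>E UNIV (\<lambda>_. sphere 0 1) \<inter> ?E = dyadic_tower J"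
    unfolding dyadic_tower_def PiE_iff by auto
  ultimately show ?thesis by simp
qed

lemma Hausdorff_dyadic_topology: "Hausdorff_space (dyadic_topology J)"
  by (rule Hausdorff_space_subtopology)
    (simp add: Hausdorff_space_product_topology flip: euclidean_product_topology)

text \<open>The truncation of the 2-adic integer \<open>j\<close> modulo \<open>2 ^ n\<close>.\<close>

definition partial_digits :: "nat set \<Rightarrow> nat \<Rightarrow> nat" where
  "partial_digits j n = (\<Sum>k<n. if k \<in> j then 2 ^ k else 0)"

lemma partial_digits_Suc [simp]: "partial_digits j (Suc n) = partial_digits j n + (if n \<in> j then 2 ^ n else 0)"
  by (simp add: partial_digits_def)

lemma partial_digits_dvd_diff:
  assumes "n \<le> N"
  obtains m where "partial_digits j N = partial_digits j n + m * 2 ^ n"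
proof -
  have "\<exists>m. partial_digits j N = partial_digits j n + m * 2 ^ n" using assms
  proof (induction N rule: dec_induct)
    case (step N)
    then obtain m where m: "partial_digits j N = partial_digits j n + m * 2 ^ n" by blast
    have "(2::nat) ^ N = 2 ^ (N - n) * 2 ^ n" using step by (simp flip: power_add)
    then show ?case using m 
      by (intro exI[of _ "m + (if N \<in> j then 2 ^ (N - n) else 0)"]) (simp add: algebra_simps)
  qed (auto intro: exI[of _ 0])
  then show thesis using that by blast
qed

lemma cis_double: "cis (2 * a) = (cis a)\<^sup>2"
  by (simp add: power2_eq_square cis_mult)

text \<open>For fixed \<open>J\<close>, a homomorphism from the real vector space of pairs \<open>(\<theta>, t)\<close> to the group, given by
  \<open>z = exp (2 \<pi> i \<theta>)\<close> and \<open>w\<^sub>j\<^sub>,\<^sub>0 = exp (2 \<pi> i t\<^sub>j)\<close>; the angle of \<open>w\<^sub>j\<^sub>,\<^sub>n\<close> results from solving the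
  recursion over the reals. Its restrictions to lines are the one-parameter subgroups.\<close>

definition one_parameter :: "nat set set \<Rightarrow> real \<Rightarrow> (nat set \<Rightarrow> real) \<Rightarrow> nat set \<Rightarrow> complex" where
  "one_parameter J \<theta> t i =
     (if i \<notin> coordinates J then 1 else if i = {} then cis (2 * pi * \<theta>)
      else cis (2 * pi * (t (code_digits i) - \<theta> * partial_digits (code_digits i) (code_level i)) / 2 ^ code_level i))"

lemma one_parameter_simps:
  "one_parameter J \<theta> t {} = cis (2 * pi * \<theta>)"
  "j \<in> J \<Longrightarrow> one_parameter J \<theta> t (encode j n) = cis (2 * pi * (t j - \<theta> * partial_digits j n) / 2 ^ n)"
  "i \<notin> coordinates J \<Longrightarrow> one_parameter J \<theta> t i = 1"
  by (simp_all add: one_parameter_def)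

lemma one_parameter_in_dyadic_tower: "one_parameter J \<theta> t \<in> dyadic_tower J"
proof -
  have "one_parameter J \<theta> t (encode j n) =
      (if n \<in> j then one_parameter J \<theta> t {} else 1) * (one_parameter J \<theta> t (encode j (Suc n)))\<^sup>2"
    if j: "j \<in> J" for j n
  proof -
    let ?b = "2 * pi * (t j - \<theta> * partial_digits j (Suc n)) / 2 ^ Suc n"
    let ?c = "if n \<in> j then 2 * pi * \<theta> else 0"
    have "2 * pi * (t j - \<theta> * partial_digits j n) / 2 ^ n = ?c + 2 * ?b"
      by (simp add: field_simps)
    then have "cis (2 * pi * (t j - \<theta> * partial_digits j n) / 2 ^ n) = cis ?c * cis (2 * ?b)"
      by (simp only: cis_mult)
    moreover have "cis (2 * ?b) = (cis ?b)\<^sup>2" by (rule cis_double)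
    moreover have "cis ?c = (if n \<in> j then cis (2 * pi * \<theta>) else 1)" by simp
    ultimately show ?thesis
      unfolding one_parameter_simps(1) one_parameter_simps(2)[OF j] by (simp only:)
  qed
  moreover have "norm (one_parameter J \<theta> t i) = 1" for i by (simp add: one_parameter_def)
  ultimately show ?thesis by (intro dyadic_towerI one_parameter_simps(3))
qed

lemma continuous_on_one_parameter:
  assumes "continuous_on S a" "\<And>j. continuous_on S (\<lambda>s. b s j)"
  shows "continuous_on S (\<lambda>s. one_parameter J (a s) (b s))"
proof (rule continuous_on_coordinatewise_then_product)
  fix i
  show "continuous_on S (\<lambda>s. one_parameter J (a s) (b s) i)"
    unfolding one_parameter_def
    by (cases "i \<notin> coordinates J"; cases "i = {}") (auto intro!: continuous_intros assms)
qed

text \<open>The coordinates of level at most \<open>N\<close> are determined by \<open>z\<close> and those of level \<open>N\<close>, and these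
  can be prescribed freely. Here \<open>t j\<close> is chosen such that the angle at level \<open>N\<close> is that of
  \<open>x (encode j N)\<close>.\<close>

lemma one_parameter_matches_finite_levels:
  assumes x: "x \<in> dyadic_tower J"
  obtains \<theta> t where "\<And>i. i \<in> coordinates J \<Longrightarrow> code_level i \<le> N \<Longrightarrow> one_parameter J \<theta> t i = x i"
proof -
  have "\<exists>a. cis (2 * pi * a) = x i" for i
  proof -
    have "x i = cis (Arg (x i))" using cis_Arg[of "x i"] dyadic_towerD(1,2)[OF x] by (simp add: sgn_eq)
    then show ?thesis by (intro exI[of _ "Arg (x i) / (2 * pi)"]) simp
  qed
  then obtain a where a: "\<And>i. cis (2 * pi * a i) = x i" by metis
  define t where "t j = a {} * partial_digits j N + 2 ^ N * a (encode j N)" for j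
  let ?y = "one_parameter J (a {}) t"
  have y: "?y \<in> dyadic_tower J" by (rule one_parameter_in_dyadic_tower)
  have 0: "?y {} = x {}" by (simp add: one_parameter_simps a)
  have "?y (encode j n) = x (encode j n)" if j: "j \<in> J" and n: "n \<le> N" for j n
    using n
  proof (induction n rule: inc_induct)
    case base
    then show ?case using j a[of "encode j N"] by (simp add: one_parameter_simps t_def mult.assoc)
  next
    case (step n)
    then show ?case
      by (subst dyadic_towerD(4)[OF x j], subst dyadic_towerD(4)[OF y j]) (simp add: 0)
  qed
  then have "?y i = x i" if "i \<in> coordinates J" "code_level i \<le> N" for i
    using that 0 by (auto elim!: coordinates_cases)
  then show thesis using that by blast
qed

lemma dyadic_neighbourhood:
  assumes "openin (dyadic_topology J) U" "x \<in> U"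
  obtains V F where "finite F" "F \<subseteq> coordinates J" "\<And>i. open (V i)" "\<And>i. x i \<in> V i"
    "\<forall>y\<in>dyadic_tower J. (\<forall>i\<in>F. y i \<in> V i) \<longrightarrow> y \<in> U"
proof -
  obtain T where T: "open T" "U = dyadic_tower J \<inter> T" using assms(1) by (auto simp: openin_open)
  have "openin (product_topology (\<lambda>_. euclidean) UNIV) T" using T(1) by (simp add: euclidean_product_topology)
  then obtain V where V: "finite {i. V i \<noteq> UNIV}" "\<And>i. open (V i)" "x \<in> Pi\<^sub>E UNIV V" "Pi\<^sub>E UNIV V \<subseteq> T"
    using assms(2) T(2) unfolding openin_product_topology_alt by force
  have xV: "x i \<in> V i" for i using V(3) by auto
  show thesis
  proof
    show "finite ({i. V i \<noteq> UNIV} \<inter> coordinates J)" using V(1) by blast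
    show "\<forall>y\<in>dyadic_tower J. (\<forall>i\<in>{i. V i \<noteq> UNIV} \<inter> coordinates J. y i \<in> V i) \<longrightarrow> y \<in> U"
    proof (intro ballI impI)
      fix y assume y: "y \<in> dyadic_tower J" and F: "\<forall>i\<in>{i. V i \<noteq> UNIV} \<inter> coordinates J. y i \<in> V i"
      have "y i \<in> V i" for i
      proof (cases "i \<in> coordinates J")
        case True
        then show ?thesis using F by blast
      next
        case False
        then have "y i = x i"
          using dyadic_towerD(3)[OF y False] dyadic_towerD(3)[of x J i] assms(2) T(2) by simp
        then show ?thesis using xV by simp
      qed
      then show "y \<in> U" using V(4) y T(2) by auto
    qed
  qed (use V xV in auto)
qed

text \<open>The points on one-parameter subgroups form a connected set, which is dense because it attains
  all values on finitely many coordinates.\<close>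

lemma connected_dyadic_tower: "connected (dyadic_tower J)"
proof (rule connected_intermediate_closure)
  let ?P = "range (\<lambda>(\<theta>, t). one_parameter J \<theta> t)"
  let ?I = "\<lambda>(\<theta>, t). (\<lambda>s. one_parameter J (s * \<theta>) (\<lambda>j. s * t j)) ` {0..1}"
  show "connected ?P"
  proof -
    have "connected (\<Union> (range ?I))"
    proof (rule connected_Union)
      fix S assume "S \<in> range ?I"
      then obtain \<theta> t where S: "S = (\<lambda>s. one_parameter J (s * \<theta>) (\<lambda>j. s * t j)) ` {0..1}" by auto
      have "continuous_on {0..1} (\<lambda>s. one_parameter J (s * \<theta>) (\<lambda>j. s * t j))"
        by (intro continuous_on_one_parameter continuous_intros)
      then show "connected S" unfolding S by (rule connected_continuous_image) simp
    next
      have "one_parameter J 0 (\<lambda>_. 0) \<in> \<Inter> (range ?I)" 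
      proof (rule InterI)
        fix S assume "S \<in> range ?I"
        then obtain \<theta> t where S: "S = (\<lambda>s. one_parameter J (s * \<theta>) (\<lambda>j. s * t j)) ` {0..1}" by auto
        show "one_parameter J 0 (\<lambda>_. 0) \<in> S" unfolding S by (rule image_eqI[of _ _ 0]) simp_all
      qed
      then show "\<Inter> (range ?I) \<noteq> {}" by blast
    qed
    moreover have "\<Union> (range ?I) = ?P"
    proof
      show "?P \<subseteq> \<Union> (range ?I)"
      proof clarify
        fix \<theta> t
        have "one_parameter J \<theta> t \<in> ?I (\<theta>, t)" by (auto intro!: image_eqI[of _ _ 1])
        then show "one_parameter J \<theta> t \<in> \<Union> (range ?I)" by blast
      qed
    qed auto
    ultimately show ?thesis by simp
  qed
  show "?P \<subseteq> dyadic_tower J" using one_parameter_in_dyadic_tower by auto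
  show "dyadic_tower J \<subseteq> closure ?P"
  proof
    fix x assume x: "x \<in> dyadic_tower J"
    show "x \<in> closure ?P"
      unfolding closure_iff_nhds_not_empty
    proof (intro allI impI)
      fix A U assume U: "U \<subseteq> A" "open U" "x \<in> U"
      have openU: "openin (dyadic_topology J) (dyadic_tower J \<inter> U)" using U(2) by blast
      obtain V F where F: "finite F" "F \<subseteq> coordinates J" "\<And>i. open (V i)" "\<And>i. x i \<in> V i"
        "\<forall>y\<in>dyadic_tower J. (\<forall>i\<in>F. y i \<in> V i) \<longrightarrow> y \<in> dyadic_tower J \<inter> U"
        using that by (rule dyadic_neighbourhood[OF openU IntI[OF x U(3)]])
      obtain \<theta> t where \<theta>: "\<And>i. i \<in> coordinates J \<Longrightarrow> code_level i \<le> Max (code_level ` F) \<Longrightarrow>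
          one_parameter J \<theta> t i = x i"
        using one_parameter_matches_finite_levels[OF x, where N = "Max (code_level ` F)"] by metis
      have "one_parameter J \<theta> t i \<in> V i" if "i \<in> F" for i
      proof -
        have "one_parameter J \<theta> t i = x i" using that F(1,2) by (intro \<theta>) auto
        then show ?thesis using F(4) by simp
      qed
      then have "one_parameter J \<theta> t \<in> U" using F(5) one_parameter_in_dyadic_tower by blast
      then show "?P \<inter> A \<noteq> {}" using U(1) by auto
    qed
  qed
qed

text \<open>A square root \<open>q\<close> of \<open>z\<close> depends on finitely many coordinates only, up to an error smaller than
  the distance 2 between its two possible values. Let \<open>N\<close> bound the levels of these coordinates.
  Along the arc with \<open>z = exp (2 \<pi> i \<theta>)\<close> and \<open>w\<^sub>j\<^sub>,\<^sub>N = 1\<close>, for \<open>0 \<le> \<theta> \<le> 1\<close>, they return to their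
  initial values, whereas \<open>q\<close> changes sign.\<close>

lemma no_square_root_dyadic_tower: "\<not> has_square_root (dyadic_topology J) (\<lambda>x. x {})"
proof
  let ?T = "dyadic_topology J"
  assume "has_square_root ?T (\<lambda>x. x {})"
  then obtain q where q: "continuous_on (dyadic_tower J) q" "\<And>x. x \<in> dyadic_tower J \<Longrightarrow> x {} = (q x)\<^sup>2"
    unfolding has_square_root_def by auto
  have T: "?T = subtopology (product_topology (\<lambda>_. euclidean) UNIV) (dyadic_tower J)"
    by (simp add: euclidean_product_topology)
  have cT: "compact_space ?T" using compact_dyadic_tower by (simp add: compact_space_subtopology)
  have qT: "continuous_map ?T euclidean q" using q(1) by simp
  obtain F where F: "finite F"
    "\<forall>x\<in>topspace ?T. \<forall>y\<in>topspace ?T. (\<forall>i\<in>F. x i = y i) \<longrightarrow> dist (q x) (q y) < 1"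
    using that by (rule compact_subproduct_finite_dependence
      [OF cT[unfolded T] qT[unfolded T] zero_less_one, folded T])
  define N where "N = Max (code_level ` F)"
  \<comment> \<open>This choice of \<open>t\<close> makes the angle at level \<open>N\<close> vanish.\<close>
  define c where "c \<theta> = one_parameter J \<theta> (\<lambda>j. \<theta> * partial_digits j N)" for \<theta>
  have cG: "c \<theta> \<in> dyadic_tower J" for \<theta> unfolding c_def by (rule one_parameter_in_dyadic_tower)
  have cc: "continuous_on {0..1} c" unfolding c_def
    by (intro continuous_on_one_parameter continuous_intros)
  have closes_up: "c 1 i = c 0 i" if i: "i \<in> F" for i
  proof (cases "i \<in> coordinates J")
    case True
    then show ?thesis
    proof (cases rule: coordinates_cases)
      case 1
      then show ?thesis by (simp add: c_def one_parameter_simps)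
    next
      case (2 j n)
      then have "n \<le> N" using i F(1) unfolding N_def by (metis Max_ge code_level_encode finite_imageI imageI)
      then obtain m where m: "partial_digits j N = partial_digits j n + m * 2 ^ n" by (rule partial_digits_dvd_diff)
      have "2 * pi * (1 * real (partial_digits j N) - 1 * real (partial_digits j n)) / 2 ^ n = 2 * pi * of_nat m"
        by (simp add: m)
      then have "c 1 i = cis (2 * pi * of_nat m)" unfolding c_def 2(2) one_parameter_simps(2)[OF 2(1)] by simp
      then show ?thesis using 2 by (simp add: c_def one_parameter_simps cis_multiple_2pi)
    qed
  next
    case False
    then show ?thesis by (simp add: c_def one_parameter_simps)
  qed
  define g where "g \<theta> = q (c \<theta>) / cis (pi * \<theta>)" for \<theta>
  have "continuous_on {0..1} (\<lambda>\<theta>. q (c \<theta>))"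
    using continuous_on_compose2[OF q(1) cc] cG by blast
  then have "continuous_on {0..1} g" unfolding g_def by (intro continuous_intros) auto
  moreover have "g ` {0..1} \<subseteq> {1, -1}"
  proof clarify
    fix \<theta> :: real assume "g \<theta> \<noteq> 1"
    have "(q (c \<theta>))\<^sup>2 = cis (2 * pi * \<theta>)" 
      using q(2)[OF cG] by (simp add: c_def one_parameter_simps)
    moreover have "(cis (pi * \<theta>))\<^sup>2 = cis (2 * pi * \<theta>)"
      using cis_double[of "pi * \<theta>"] by (simp add: mult.assoc)
    ultimately have "(g \<theta>)\<^sup>2 = 1" by (simp add: g_def power_divide)
    then show "g \<theta> = -1" using \<open>g \<theta> \<noteq> 1\<close> by (simp add: power2_eq_1_iff)
  qed
  ultimately have "g constant_on {0..1}"
    by (intro continuous_finite_range_constant) (auto intro: finite_subset)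
  then have "g 1 = g 0" unfolding constant_on_def by force
  then have "q (c 1) = - q (c 0)" by (simp add: g_def minus_equation_iff[of "q (c 1)"])
  moreover have "dist (q (c 1)) (q (c 0)) < 1" using F(2) closes_up cG by simp
  moreover have "norm (q (c 0)) = 1"
  proof -
    have "norm ((q (c 0))\<^sup>2) = 1" using q(2)[OF cG, of 0] dyadic_towerD(1)[OF cG] by metis
    then show ?thesis using norm_ge_zero[of "q (c 0)"] by (auto simp: norm_power power2_eq_1_iff)
  qed
  ultimately show False by (simp add: dist_norm norm_mult flip: mult_2)
qed

theorem twisted_dyadic_tower:
  assumes "uncountable J"
  shows "twisted (dyadic_topology J) (\<lambda>x. x {})"
proof -
  have "dyadic_expansion (dyadic_topology J) (\<lambda>x. x {}) j (\<lambda>n x. x (encode j n))" if "j \<in> J" for j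
    unfolding dyadic_expansion_def
    using that dyadic_towerD(1) dyadic_towerD(4) continuous_map_coordinate by (simp; blast)
  then have "J \<subseteq> {j. \<exists>w. dyadic_expansion (dyadic_topology J) (\<lambda>x. x {}) j w}" by blast
  then have "uncountable {j. \<exists>w. dyadic_expansion (dyadic_topology J) (\<lambda>x. x {}) j w}"
    using assms countable_subset by blast
  then show ?thesis
    unfolding twisted_def
    using compact_dyadic_tower no_square_root_dyadic_tower continuous_map_coordinate dyadic_towerD(1)
    by (auto simp: compact_space_subtopology)
qed

section \<open>Weight\<close>

lemma card_of_lists_ordLeq:
  assumes A: "infinite A"
  shows "|lists A| \<le>o |A|"
proof -
  have len: "|{xs \<in> lists A. length xs = n}| \<le>o |A|" for n
  proof (induction n)
    case 0
    have "{xs \<in> lists A. length xs = 0} = {[]}" by auto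
    then show ?case using card_of_singl_ordLeq[of A "[]"] A by auto
  next
    case (Suc n)
    let ?L = "{xs \<in> lists A. length xs = n}"
    have "{xs \<in> lists A. length xs = Suc n} \<subseteq> (\<lambda>(x, xs). x # xs) ` (A \<times> ?L)"
      by (auto simp: length_Suc_conv image_iff)
    then have "|{xs \<in> lists A. length xs = Suc n}| \<le>o |A \<times> ?L|" by (rule surj_imp_ordLeq)
    moreover have "|A \<times> ?L| \<le>o |A|"
      using Suc A by (intro card_of_Sigma_ordLeq_infinite) (auto intro: card_of_mono1)
    ultimately show ?case by (rule ordLeq_transitive)
  qed
  have "lists A = (\<Union>n. {xs \<in> lists A. length xs = n})" by auto
  moreover have "|\<Union>n. {xs \<in> lists A. length xs = n}| \<le>o |A|"
    using A len by (intro card_of_UNION_ordLeq_infinite) (auto simp flip: infinite_iff_card_of_nat)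
  ultimately show ?thesis by simp
qed

lemma card_of_coordinates_Times_nat:
  assumes "infinite J"
  shows "|coordinates J \<times> (UNIV :: nat set)| \<le>o |J|" "infinite (coordinates J \<times> (UNIV :: nat set))"
proof -
  have nat: "|UNIV :: nat set| \<le>o |J|" using assms by (simp add: infinite_iff_card_of_nat)
  have "|J \<times> (UNIV :: nat set)| \<le>o |J|"
    using nat assms by (intro card_of_Sigma_ordLeq_infinite) (auto intro: card_of_mono1)
  then have "|(\<lambda>(j, n). encode j n) ` (J \<times> (UNIV :: nat set))| \<le>o |J|"
    by (rule ordLeq_transitive[OF card_of_image])
  moreover have "|{{}}| \<le>o |J|" using assms by (intro card_of_singl_ordLeq) auto
  ultimately have "|{{}} \<union> (\<lambda>(j, n). encode j n) ` (J \<times> (UNIV :: nat set))| \<le>o |J|"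
    using assms by (intro card_of_Un_ordLeq_infinite_Field) (simp_all add: Field_card_of card_of_card_order_on)
  then have "|coordinates J| \<le>o |J|" by (simp add: coordinates_def)
  then show "|coordinates J \<times> (UNIV :: nat set)| \<le>o |J|"
    using nat assms by (intro card_of_Sigma_ordLeq_infinite) auto
  show "infinite (coordinates J \<times> (UNIV :: nat set))"
    by (auto simp: finite_cartesian_product_iff coordinates_def)
qed

lemma dyadic_topology_base:
  assumes J: "infinite J"
  obtains \<B> where "base_of (dyadic_topology J) \<B>" "|\<B>| \<le>o |J|"
proof -
  obtain B :: "nat \<Rightarrow> complex set" where B: "inj B" "\<And>n. open (B n)"
      "\<And>S. open S \<Longrightarrow> \<exists>k. S = \<Union>{B n |n. n \<in> k}"
    by (rule univ_second_countable_sequence[where 'a = complex]) (rule that)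
  have Bx: "\<exists>n. u \<in> B n \<and> B n \<subseteq> S" if S: "open S" "u \<in> S" for S u
  proof -
    obtain k where k: "S = \<Union>{B n |n. n \<in> k}" using B(3)[OF S(1)] ..
    then obtain n where "n \<in> k" "u \<in> B n" using S(2) by blast
    then show ?thesis using k by blast
  qed
  define box where "box P = {x \<in> dyadic_tower J. \<forall>(i, n) \<in> set P. x i \<in> B n}" for P
  let ?I = "coordinates J \<times> (UNIV :: nat set)"
  have "base_of (dyadic_topology J) (box ` lists ?I)"
    unfolding base_of_def openin_topology_base_unique
  proof (intro conjI allI impI)
    fix V assume "V \<in> box ` lists ?I"
    then obtain P where V: "V = box P" by blast
    have "open (\<Inter>(i, n)\<in>set P. {x :: nat set \<Rightarrow> complex. x i \<in> B n})"
    proof (rule open_INT)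
      show "\<forall>p\<in>set P. open (case p of (i, n) \<Rightarrow> {x :: nat set \<Rightarrow> complex. x i \<in> B n})"
        using product_topology_basis'[of "{i}" "\<lambda>_. B n" "\<lambda>i. i" for i n] B(2) by auto
    qed simp
    moreover have "V = dyadic_tower J \<inter> (\<Inter>(i, n)\<in>set P. {x. x i \<in> B n})"
      unfolding V box_def by auto
    ultimately show "openin (dyadic_topology J) V" by blast
  next
    fix U x assume "openin (dyadic_topology J) U \<and> x \<in> U"
    then have U: "openin (dyadic_topology J) U" and x: "x \<in> U" by auto
    then have xG: "x \<in> dyadic_tower J" using openin_subset by fastforce
    obtain V F where F: "finite F" "F \<subseteq> coordinates J" "\<And>i. open (V i)" "\<And>i. x i \<in> V i"
      "\<forall>y\<in>dyadic_tower J. (\<forall>i\<in>F. y i \<in> V i) \<longrightarrow> y \<in> U"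
      using that by (rule dyadic_neighbourhood[OF U x])
    have "\<exists>n. x i \<in> B n \<and> B n \<subseteq> V i" for i using Bx F(3,4) by blast
    then obtain m where m: "\<And>i. x i \<in> B (m i)" "\<And>i. B (m i) \<subseteq> V i" by metis
    obtain as where as: "set as = F" using finite_list F(1) by blast
    let ?P = "map (\<lambda>i. (i, m i)) as"
    have "?P \<in> lists ?I" using as F(2) by auto
    moreover have "x \<in> box ?P" using xG m(1) by (simp add: box_def)
    moreover have "box ?P \<subseteq> U"
    proof
      fix y assume y: "y \<in> box ?P"
      then have "\<forall>i\<in>F. y i \<in> V i" using m(2) as by (auto simp: box_def)
      then show "y \<in> U" using F(5) y by (simp add: box_def)
    qed
    ultimately show "\<exists>V. V \<in> box ` lists ?I \<and> x \<in> V \<and> V \<subseteq> U" by blast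
  qed
  moreover have "|box ` lists ?I| \<le>o |J|"
    by (rule ordLeq_transitive[OF card_of_image
          ordLeq_transitive[OF card_of_lists_ordLeq[OF card_of_coordinates_Times_nat(2)[OF J]]
            card_of_coordinates_Times_nat(1)[OF J]]])
  ultimately show thesis using that by blast
qed

lemma base_of_countable_imp_second_countable:
  assumes "base_of X \<B>" "countable \<B>"
  shows "second_countable X"
  unfolding second_countable using assms by (auto simp: base_of_def)

lemma uncountable_Field_omega1: "uncountable (Field omega1)"
proof
  assume "countable (Field omega1)"
  then have "|Field omega1| \<le>o natLeq" by (simp add: countable_card_le_natLeq)
  moreover have "|Field omega1| =o omega1"
    by (rule card_of_Field_ordIso[OF cardSuc_Card_order[OF natLeq_Card_order]])
  ultimately have "omega1 \<le>o natLeq" using ordIso_ordLeq_trans ordIso_symmetric by blast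
  then show False using cardSuc_greater[OF natLeq_Card_order] not_ordLess_ordLeq by blast
qed

text \<open>A countable base is excluded because the group is compact and carries a twisted function.\<close>

lemma has_weight_dyadic_topology: "has_weight (dyadic_topology (Field omega1)) omega1"
proof -
  let ?J = "Field omega1"
  have J: "|?J| =o omega1"
    by (rule card_of_Field_ordIso[OF cardSuc_Card_order[OF natLeq_Card_order]])
  have lower: "omega1 \<le>o |\<B>|" if \<B>: "base_of (dyadic_topology ?J) \<B>" for \<B>
  proof -
    have "\<not> countable \<B>"
      using base_of_countable_imp_second_countable[OF \<B>] second_countable_not_twisted
        twisted_dyadic_tower[OF uncountable_Field_omega1] by blast
    then have "\<not> |\<B>| \<le>o natLeq" by (simp add: countable_card_le_natLeq)
    then have "natLeq <o |\<B>|"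
      using not_ordLeq_iff_ordLess natLeq_Well_order card_of_Well_order by blast
    then show ?thesis
      using cardSuc_least natLeq_Card_order card_of_Card_order by blast
  qed
  have "infinite ?J" using uncountable_Field_omega1 countable_finite by blast
  then obtain \<B> where \<B>: "base_of (dyadic_topology ?J) \<B>" "|\<B>| \<le>o |?J|"
    using dyadic_topology_base by blast
  have "|\<B>| \<le>o omega1" using \<B>(2) J by (rule ordLeq_ordIso_trans)
  then have "|\<B>| =o omega1" using lower[OF \<B>(1)] by (simp add: ordIso_iff_ordLeq)
  then show ?thesis unfolding has_weight_def using \<B>(1) lower by blast
qed

section \<open>A compact connected group outside the class R\<close>

theorem theorem2p1:
  shows "\<exists>(G :: (nat set \<Rightarrow> complex) monoid) (T :: (nat set \<Rightarrow> complex) topology).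
           comm_group G \<and> topological_group G T \<and>
           compact_space T \<and> Hausdorff_space T \<and> connected_space T \<and>
           has_weight T omega1 \<and>
           \<not> class_R T \<and> \<not> valdivia_compact T"
proof (intro exI conjI)
  let ?G = "dyadic_group (Field omega1)" and ?T = "dyadic_topology (Field omega1)"
  have twisted: "twisted ?T (\<lambda>x. x {})"
    by (rule twisted_dyadic_tower[OF uncountable_Field_omega1])
  show "comm_group ?G" by (rule comm_group_dyadic_group)
  show "topological_group ?G ?T" by (rule topological_group_dyadic_group)
  show "compact_space ?T" using twisted by (simp add: twisted_def)
  show "Hausdorff_space ?T" by (rule Hausdorff_dyadic_topology)
  show "connected_space ?T"
    using connected_dyadic_tower by (metis connectedin_def connectedin_iff_connected)
  show "has_weight ?T omega1" by (rule has_weight_dyadic_topology)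
  show "\<not> class_R ?T" using twisted class_R_not_twisted by blast
  show "\<not> valdivia_compact ?T" using twisted valdivia_compact_not_twisted by blast
qed

end
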